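(* Let $K$ be a field of characteristic $p>0$ and let $a\in K^{{\mathbb N}}$ be a nonzero simple nondegenerate $K$-recurrence sequence of order $d$. Then ${\mathcal Z}(a)=\{n\in{\mathbb N}\mid a(n)=0\}$ is a $p$-nested set of order $\le d-2$.
   Context: ${\mathbb N}=\{0,1,2,\dots\}$. Let $E$ be the shift operator $(Ea)(n)=a(n+1)$, making $K^{{\mathbb N}}$ a $K[E]$-module. For a $K$-recurrence sequence $a$ (one with $P(E)a=0$ for some nonzero $P$), the ideal $\{P\in K[E]\mid P(E)a=0\}$ is generated by a unique monic polynomial $P_a$, the minimum polynomial; its degree is the order of $a$. $a$ is simple if all roots of $P_a$ (in an algebraic closure) are distinct, and nondegenerate if all roots of $P_a$ are nonzero and the quotient of any two distinct roots is not a root of unity. Let $q$ be a power of $p$. For $r\ge1$ and $c_0,\dots,c_r\in{\mathbb Q}$ with $(q-1)c_i\in{\mathbb Z}$, $c_0+\cdots+c_r\in{\mathbb Z}$, $c_i\neq0$ for $1\le i\le r$ and $c_i>0$ for some $1\le i\le r$, the set $S_q(c_0;c_1,\dots,c_r)=\{c_0+\sum_{i=1}^rc_iq^{k_i}\mid k_1,\dots,k_r\in{\mathbb N}\}\cap{\mathbb N}$ is an elementary $p$-nested set of order $r$. A $p$-nested set of order $\le k$ is the union of a finite set and finitely many elementary $p$-nested sets (possibly for different powers $q$ of $p$) of orders $\le k$; for $k\le0$ it is just a finite set. *)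

theory Defs
  imports "HOL-Algebra.Algebraic_Closure_Type"
begin

definition shift_apply :: "'a::comm_ring_1 poly \<Rightarrow> (nat \<Rightarrow> 'a) \<Rightarrow> (nat \<Rightarrow> 'a)" where
  "shift_apply P a = (\<lambda>n. \<Sum>i\<le>degree P. coeff P i * a (n + i))"

definition is_recurrence :: "(nat \<Rightarrow> 'a::field) \<Rightarrow> bool" where
  "is_recurrence a \<longleftrightarrow> (\<exists>P. P \<noteq> 0 \<and> shift_apply P a = (\<lambda>_. 0))"

definition min_poly_seq :: "(nat \<Rightarrow> 'a::field) \<Rightarrow> 'a poly" where
  "min_poly_seq a = (THE P. lead_coeff P = 1 \<and> shift_apply P a = (\<lambda>_. 0) \<and>
      (\<forall>Q. shift_apply Q a = (\<lambda>_. 0) \<longrightarrow> P dvd Q))"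

definition seq_order :: "(nat \<Rightarrow> 'a::field) \<Rightarrow> nat" where
  "seq_order a = degree (min_poly_seq a)"

definition roots_ac :: "'a::field poly \<Rightarrow> 'a alg_closure set" where
  "roots_ac P = {x. poly (map_poly to_ac P) x = 0}"

definition simple_seq :: "(nat \<Rightarrow> 'a::field) \<Rightarrow> bool" where
  "simple_seq a \<longleftrightarrow> rsquarefree (map_poly to_ac (min_poly_seq a))"

definition nondegenerate_seq :: "(nat \<Rightarrow> 'a::field) \<Rightarrow> bool" where
  "nondegenerate_seq a \<longleftrightarrow>
     (\<forall>x\<in>roots_ac (min_poly_seq a). x \<noteq> 0) \<and>
     (\<forall>x\<in>roots_ac (min_poly_seq a). \<forall>y\<in>roots_ac (min_poly_seq a).
        x \<noteq> y \<longrightarrow> \<not> (\<exists>n>0. (x / y) ^ n = 1))"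

definition zero_set :: "(nat \<Rightarrow> 'a::zero) \<Rightarrow> nat set" where
  "zero_set a = {n. a n = 0}"

definition valid_elem_params :: "nat \<Rightarrow> nat \<Rightarrow> rat \<Rightarrow> rat list \<Rightarrow> bool" where
  "valid_elem_params p q c0 cs \<longleftrightarrow>
     (\<exists>e\<ge>1. q = p ^ e) \<and> length cs \<ge> 1 \<and>
     (\<forall>c\<in>set (c0 # cs). (of_nat q - 1) * c \<in> \<int>) \<and>
     c0 + sum_list cs \<in> \<int> \<and>
     (\<forall>c\<in>set cs. c \<noteq> 0) \<and> (\<exists>c\<in>set cs. c > 0)"

definition elem_set :: "nat \<Rightarrow> rat \<Rightarrow> rat list \<Rightarrow> nat set" where
  "elem_set q c0 cs = {n. \<exists>ks::nat list. length ks = length cs \<and>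
       of_nat n = c0 + (\<Sum>i<length cs. cs ! i * of_nat q ^ (ks ! i))}"

text \<open>p-nested set of order at most k (k an integer; for k \<le> 0 only finite sets).\<close>
definition p_nested_le :: "nat \<Rightarrow> int \<Rightarrow> nat set \<Rightarrow> bool" where
  "p_nested_le p k Z \<longleftrightarrow>
     (\<exists>F D. finite F \<and> finite D \<and>
        (\<forall>(q, c0, cs)\<in>D. valid_elem_params p q c0 cs \<and> int (length cs) \<le> k) \<and>
        Z = F \<union> (\<Union>(q, c0, cs)\<in>D. elem_set q c0 cs))"

end

theory Submission
  imports Defs
begin

text \<open>
  Over the algebraic closure the sequence is an exponential sum \<open>\<Sum>\<^sub>i c\<^sub>i \<alpha>\<^sub>i\<^sup>n\<close> with \<open>d\<close> terms, so its
  zeros are the \<open>n\<close> for which the point \<open>pt n = (\<alpha>\<^sub>i\<^sup>n)\<^sub>i\<close> lies in a hyperplane. Writing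
  \<open>n = p n' + j\<close>, the point is the image of \<open>pt n'\<close> under the Frobenius map followed by the \<open>j\<close>-th
  power of a diagonal matrix, so membership in a subspace \<open>U\<close> becomes membership of \<open>pt n'\<close> in
  another subspace \<open>U'\<close> of at most the same rank. Since all \<open>c\<^sub>i\<close> and \<open>\<alpha>\<^sub>i\<close> lie in a finitely
  generated ring, only finitely many subspaces occur: reading the \<open>p\<close>-adic digits of \<open>n\<close> is a run of
  a finite automaton along which the rank never increases. Nondegeneracy forces the digits of
  any run that leads from a recurring state to a recurring state of the same rank, so, apart
  from these unique cycles, the rank drops. Each cycle \<open>n \<mapsto> q n + j\<close>
  contributes one free exponent. Restrictions between the exponents can be removed, because
  the Frobenius map is a rank-preserving bijection: a subspace that contains the points for all
  large exponents contains them for all exponents.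
\<close>

subsection \<open>Frobenius and diagonal matrices acting on subspaces\<close>

lemma nat_power_mod_split: "(n::nat) mod (p ^ Suc e) = n mod p + p * (n div p mod p ^ e)"
  by (simp add: mod_mult2_eq)

text \<open>The integer (q^l - 1)/(q - 1). Iterating n to q n + J exactly l times sends n to
  \<open>q ^ l * n + J * bracket q l\<close>, and writing nested sets with \<open>bracket\<close>
  instead of powers keeps their parameters integral.\<close>

definition bracket :: "nat \<Rightarrow> nat \<Rightarrow> int" where
  "bracket q l = (\<Sum>i<l. int q ^ i)"

lemma bracket_0 [simp]: "bracket q 0 = 0"
  by (simp add: bracket_def)

lemma bracket_Suc: "bracket q (Suc l) = bracket q l + int q ^ l"
  by (simp add: bracket_def)

lemma bracket_mult: "(int q - 1) * bracket q l = int q ^ l - 1"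
  by (induction l) (auto simp: bracket_Suc algebra_simps)

lemma bracket_add: "bracket q (k + l) = bracket q l + int q ^ l * bracket q k"
  by (induction k) (auto simp: bracket_Suc algebra_simps power_add)

lemma bracket_Suc': "bracket q (Suc l) = 1 + int q * bracket q l"
  using bracket_add[of q l 1] by (simp add: bracket_Suc)

lemma all_ge_Suc: "(\<forall>l\<ge>Suc m. P l) \<longleftrightarrow> (\<forall>l\<ge>m. P (Suc l))"
  by (metis Suc_le_D Suc_le_mono)

text \<open>Surjectivity of Frobenius, which holds in an algebraic closure, makes Frobenius images
  of subspaces subspaces again. Nonzero \<open>\<alpha> i\<close> even beyond \<open>d\<close> lets
  integer powers behave in every coordinate.\<close>

locale frobenius_diagonal =
  fixes \<alpha> :: "nat \<Rightarrow> 'b::field" and d p :: nat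
  assumes p_char: "p = CHAR('b)" and p_pos: "p > 0"
    and frobenius_surj: "\<And>x::'b. \<exists>y. y ^ p = x"
    and \<alpha>_nonzero [simp]: "\<And>i. \<alpha> i \<noteq> 0"
    and nondegenerate: "\<And>i j n. i < d \<Longrightarrow> j < d \<Longrightarrow> i \<noteq> j \<Longrightarrow> n > 0 \<Longrightarrow> \<alpha> i ^ n \<noteq> \<alpha> j ^ n"
begin

lemma prime_p: "prime p"
  using p_char p_pos prime_CHAR_semidom by blast

lemma p_ge_2: "p \<ge> 2"
  using prime_p by (rule prime_ge_2_nat)

lemma frobenius_pow_surj: "\<exists>y::'b. y ^ (p ^ e) = x"
proof (induction e arbitrary: x)
  case (Suc e)
  obtain z where "z ^ p = x" using frobenius_surj by blast
  moreover obtain y where "y ^ (p ^ e) = z" using Suc by blast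
  ultimately have "y ^ (p ^ Suc e) = x"
    by (metis power_Suc2 power_mult)
  then show ?case by blast
qed auto

lemma frobenius_add: "(x + y :: 'b) ^ (p ^ e) = x ^ (p ^ e) + y ^ (p ^ e)"
  using freshmans_dream' prime_p p_char by metis

text \<open>The \<open>e\<close>-fold Frobenius map followed by the \<open>m\<close>-th power of the
  diagonal matrix. With \<open>m\<close> an integer, the diagonal part can be undone within the
  family.\<close>

definition act :: "int \<Rightarrow> nat \<Rightarrow> (nat \<Rightarrow> 'b) \<Rightarrow> nat \<Rightarrow> 'b" where
  "act m e v = (\<lambda>i. \<alpha> i powi m * v i ^ (p ^ e))"

definition pt :: "int \<Rightarrow> nat \<Rightarrow> 'b" where
  "pt n = (\<lambda>i. if i < d then \<alpha> i powi n else 0)"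

text \<open>The ambient space of dimension \<open>d\<close> is encoded as the functions vanishing
  from \<open>d\<close> on, so that vectors agreeing on the first \<open>d\<close> coordinates are
  equal.\<close>

definition subsp :: "(nat \<Rightarrow> 'b) set \<Rightarrow> bool" where
  "subsp U \<longleftrightarrow> (\<forall>v\<in>U. \<forall>i\<ge>d. v i = 0) \<and> (\<lambda>_. 0) \<in> U \<and>
     (\<forall>u\<in>U. \<forall>v\<in>U. (\<lambda>i. u i + v i) \<in> U) \<and> (\<forall>c. \<forall>v\<in>U. (\<lambda>i. c * v i) \<in> U)"

text \<open>The number of pivots of a subspace is its dimension. Unlike bases, pivots are visibly unchanged
  by the semilinear map \<open>act m e\<close>, which acts on each coordinate separately.\<close>

definition pivots :: "(nat \<Rightarrow> 'b) set \<Rightarrow> nat set" where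
  "pivots U = {i. i < d \<and> (\<exists>v\<in>U. v i \<noteq> 0 \<and> (\<forall>j<i. v j = 0))}"

definition rank :: "(nat \<Rightarrow> 'b) set \<Rightarrow> nat" where
  "rank U = card (pivots U)"

text \<open>Moving the diagonal matrix past Frobenius raises it to its \<open>p\<close>-th power, so
  the pairs \<open>(m, e)\<close> compose like the affine maps n to m + p^e n. These maps also
  describe the effect on the exponent of \<open>pt\<close>.\<close>

lemma act_act: "act m e (act m' e' v) = act (m + int p ^ e * m') (e + e') v"
proof
  fix i
  have "(\<alpha> i powi m') ^ (p ^ e) = \<alpha> i powi (int p ^ e * m')"
    by (simp add: power_int_mult mult.commute flip: power_int_of_nat)
  moreover have "(v i ^ (p ^ e')) ^ (p ^ e) = v i ^ (p ^ (e + e'))"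
    by (simp add: power_add mult.commute flip: power_mult)
  ultimately show "act m e (act m' e' v) i = act (m + int p ^ e * m') (e + e') v i"
    by (simp add: act_def power_mult_distrib power_int_add)
qed

lemma act_pt: "act m e (pt n) = pt (m + int p ^ e * n)"
proof
  fix i
  have "(\<alpha> i powi n) ^ (p ^ e) = \<alpha> i powi (int p ^ e * n)"
    by (simp add: power_int_mult mult.commute flip: power_int_of_nat)
  then show "act m e (pt n) i = pt (m + int p ^ e * n) i"
    using p_pos by (simp add: act_def pt_def power_int_add power_0_left)
qed

lemma act_eq_0_iff [simp]: "act m e v i = 0 \<longleftrightarrow> v i = 0"
  using p_pos by (auto simp: act_def power_0_left)

lemma act_surj: "\<exists>w. act m e w = v"
proof -
  have "\<exists>y. y ^ (p ^ e) = v i / \<alpha> i powi m" for i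
    by (rule frobenius_pow_surj)
  then obtain w where "\<And>i. w i ^ (p ^ e) = v i / \<alpha> i powi m" by metis
  then have "act m e w = v" by (auto simp: act_def)
  then show ?thesis by blast
qed

lemma act_add: "act m e (\<lambda>i. u i + v i) = (\<lambda>i. act m e u i + act m e v i)"
  by (simp add: act_def frobenius_add algebra_simps)

lemma act_scale: "act m e (\<lambda>i. c * v i) = (\<lambda>i. c ^ (p ^ e) * act m e v i)"
  by (simp add: act_def power_mult_distrib mult_ac)

lemma act_zero [simp]: "act m e (\<lambda>_. 0) = (\<lambda>_. 0)"
  using p_pos by (simp add: act_def power_0_left)

lemma subsp_supp: "subsp U \<Longrightarrow> v \<in> U \<Longrightarrow> i \<ge> d \<Longrightarrow> v i = 0"
  by (auto simp: subsp_def)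

lemma subsp_add: "subsp U \<Longrightarrow> u \<in> U \<Longrightarrow> v \<in> U \<Longrightarrow> (\<lambda>i. u i + v i) \<in> U"
  by (auto simp: subsp_def)

lemma subsp_scale: "subsp U \<Longrightarrow> v \<in> U \<Longrightarrow> (\<lambda>i. c * v i) \<in> U"
  by (auto simp: subsp_def)

lemma subsp_diff: "subsp U \<Longrightarrow> u \<in> U \<Longrightarrow> v \<in> U \<Longrightarrow> (\<lambda>i. u i - v i) \<in> U"
  using subsp_add[of U u "\<lambda>i. -1 * v i"] subsp_scale[of U v "-1"] by simp

lemma subsp_image:
  assumes "subsp U" shows "subsp (act m e ` U)"
  unfolding subsp_def
proof (intro conjI ballI allI impI)
  show "(\<lambda>_. 0) \<in> act m e ` U"
    using assms by (intro image_eqI[of _ _ "\<lambda>_. 0"]) (auto simp: subsp_def)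
  show "(\<lambda>i. u i + v i) \<in> act m e ` U" if uv: "u \<in> act m e ` U" "v \<in> act m e ` U" for u v
  proof -
    obtain u' v' where "u' \<in> U" "v' \<in> U" "u = act m e u'" "v = act m e v'" using uv by blast
    then show ?thesis
      using assms by (intro image_eqI[of _ _ "\<lambda>i. u' i + v' i"]) (auto simp: act_add subsp_add)
  qed
  show "(\<lambda>i. c * v i) \<in> act m e ` U" if v: "v \<in> act m e ` U" for c v
  proof -
    \<comment> \<open>The map is only semilinear, so the scalar \<open>c\<close> is pulled back to a
      \<open>p ^ e\<close>-th root.\<close>
    obtain b where b: "b ^ (p ^ e) = c" using frobenius_pow_surj by blast
    obtain u where "u \<in> U" "v = act m e u" using v by blast
    then show ?thesis
      using assms by (intro image_eqI[of _ _ "\<lambda>i. b * u i"]) (auto simp: act_scale b subsp_scale)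
  qed
qed (use assms in \<open>auto dest: subsp_supp\<close>)

lemma pivots_image: "pivots (act m e ` U) = pivots U"
  by (auto simp: pivots_def)

lemma rank_image: "rank (act m e ` U) = rank U"
  by (simp add: rank_def pivots_image)

lemma finite_pivots [simp]: "finite (pivots U)"
  by (auto simp: pivots_def)

lemma rank_mono: "S \<subseteq> T \<Longrightarrow> rank S \<le> rank T"
  unfolding rank_def by (rule card_mono) (auto simp: pivots_def)

lemma rank_le: "rank U \<le> d"
  using card_mono[of "{..<d}" "pivots U"] by (auto simp: rank_def pivots_def)

text \<open>Inclusion and the rank bound force equal pivot sets. Elimination then stays inside
  \<open>S\<close>: a vector of \<open>T\<close> is matched on one more coordinate at each step,
  using a pivot vector of \<open>S\<close> wherever the current match fails.\<close>

lemma subsp_rank_eq: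
  assumes S: "subsp S" and T: "subsp T" and "S \<subseteq> T" and "rank T \<le> rank S"
  shows "S = T"
proof
  have piv: "pivots T = pivots S"
    using card_seteq[of "pivots T" "pivots S"] assms by (auto simp: rank_def pivots_def)
  show "T \<subseteq> S"
  proof
    fix v assume v: "v \<in> T"
    have "k \<le> d \<Longrightarrow> \<exists>s\<in>S. \<forall>j<k. s j = v j" for k
    proof (induction k)
      case 0
      then show ?case using S by (auto simp: subsp_def)
    next
      case (Suc k)
      then obtain s where s: "s \<in> S" "\<forall>j<k. s j = v j" by auto
      show ?case
      proof (cases "s k = v k")
        case True
        then show ?thesis using s less_Suc_eq by auto
      next
        case False
        have "(\<lambda>i. v i - s i) \<in> T" using subsp_diff[OF T v] s assms(3) by blast
        then have "k \<in> pivots T"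
          unfolding pivots_def using False s Suc.prems
          by (intro CollectI conjI bexI[of _ "\<lambda>i. v i - s i"]) auto
        then obtain u where u: "u \<in> S" "u k \<noteq> 0" "\<forall>j<k. u j = 0"
          unfolding piv by (auto simp: pivots_def)
        have "(\<lambda>i. s i + (v k - s k) / u k * u i) \<in> S"
          using S s u by (intro subsp_add subsp_scale)
        moreover have "\<forall>j<Suc k. s j + (v k - s k) / u k * u j = v j"
          using s u less_Suc_eq by auto
        ultimately show ?thesis by (intro bexI[of _ "\<lambda>i. s i + (v k - s k) / u k * u i"])
      qed
    qed
    then obtain s where s: "s \<in> S" "\<forall>j<d. s j = v j" by blast
    have "s = v"
    proof
      fix i show "s i = v i"
        using s v subsp_supp[OF S, of s i] subsp_supp[OF T, of v i] by (cases "i < d") auto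
    qed
    then show "v \<in> S" using s by simp
  qed
qed fact

lemma act_image_act_image: "act m e ` act m' e' ` U = act (m + int p ^ e * m') (e + e') ` U"
  by (simp add: image_image act_act)

lemma rank_le_of_act_subset: "act m e ` V \<subseteq> U \<Longrightarrow> rank V \<le> rank U"
  using rank_mono rank_image by metis

lemma act_image_eq_of_rank:
  "subsp U \<Longrightarrow> subsp V \<Longrightarrow> act m e ` V \<subseteq> U \<Longrightarrow> rank U \<le> rank V \<Longrightarrow> act m e ` V = U"
  by (simp add: rank_image subsp_image subsp_rank_eq)

text \<open>A subspace stable under a power of the diagonal matrix is a coordinate subspace, because
  the powers of the diagonal entries stay distinct.\<close>

lemma full_rank_of_stable:
  assumes W: "subsp W" and m: "m > 0" and stable: "act (int m) 0 ` W \<subseteq> W"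
    and x: "x \<in> W" "\<And>i. i < d \<Longrightarrow> x i \<noteq> 0"
  shows "rank W = d"
proof -
  \<comment> \<open>The \<open>m\<close>-th power of the diagonal matrix minus the scalar
    \<open>\<alpha> j ^ m\<close> kills coordinate \<open>j\<close> and no other. Applying this for
    each \<open>j\<close> in \<open>J\<close> to the vector \<open>x\<close> of full support leaves
    the complement of \<open>J\<close>.\<close>
  have sep: "\<exists>w\<in>W. \<forall>i<d. w i \<noteq> 0 \<longleftrightarrow> i \<notin> J" if "J \<subseteq> {..<d}" for J
  proof -
    have "finite J" using that finite_subset by blast
    then show ?thesis using that
    proof (induction J)
      case empty
      then show ?case using x by auto
    next
      case (insert j J)
      then obtain w where w: "w \<in> W" "\<forall>i<d. w i \<noteq> 0 \<longleftrightarrow> i \<notin> J" by auto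
      have "act (int m) 0 w \<in> W" using stable w by blast
      then have "(\<lambda>i. act (int m) 0 w i - \<alpha> j ^ m * w i) \<in> W"
        using W w by (auto intro: subsp_diff subsp_scale)
      moreover have "\<forall>i<d. act (int m) 0 w i - \<alpha> j ^ m * w i \<noteq> 0 \<longleftrightarrow> i \<notin> insert j J"
      proof (intro allI impI)
        fix i assume i: "i < d"
        have "act (int m) 0 w i - \<alpha> j ^ m * w i = (\<alpha> i ^ m - \<alpha> j ^ m) * w i"
          by (simp add: act_def algebra_simps)
        moreover have "\<alpha> i ^ m - \<alpha> j ^ m = 0 \<longleftrightarrow> i = j"
          using nondegenerate[of i j m] i m insert.prems by auto
        ultimately show "act (int m) 0 w i - \<alpha> j ^ m * w i \<noteq> 0 \<longleftrightarrow> i \<notin> insert j J"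
          using w i by auto
      qed
      ultimately show ?case by (intro bexI[of _ "\<lambda>i. act (int m) 0 w i - \<alpha> j ^ m * w i"])
    qed
  qed
  have "i \<in> pivots W" if "i < d" for i
  proof -
    obtain w where w: "w \<in> W" "\<forall>k<d. w k \<noteq> 0 \<longleftrightarrow> k \<notin> {..<d} - {i}"
      using sep[of "{..<d} - {i}"] by blast
    have "\<forall>k<i. w k = 0" using w(2) that by (auto dest: less_trans)
    then show ?thesis using that w unfolding pivots_def by (intro CollectI conjI bexI[of _ w]) auto
  qed
  then have "pivots W = {..<d}" by (auto simp: pivots_def)
  then show ?thesis by (simp add: rank_def)
qed

text \<open>If the exponents differed, the Frobenius image of \<open>W\<close> would be stable under
  a positive power of the diagonal matrix and hence have full rank.\<close>

lemma act_image_inject: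
  assumes W: "subsp W" and x: "x \<in> W" "\<And>i. i < d \<Longrightarrow> x i \<noteq> 0" and r: "rank W < d"
    and eq: "act a e ` W = act b e ` W"
  shows "a = b"
proof -
  have *: "\<not> b < a" if "act a e ` W = act b e ` W" for a b
  proof
    assume "b < a"
    let ?Y = "act 0 e ` W"
    have "act (a - b) 0 ` ?Y = act (- b) 0 ` act a e ` W"
      by (simp add: act_image_act_image)
    also have "\<dots> = ?Y" by (simp add: that act_image_act_image)
    finally have "act (int (nat (a - b))) 0 ` ?Y \<subseteq> ?Y" using \<open>b < a\<close> by simp
    moreover have "act 0 e x \<in> ?Y" "\<And>i. i < d \<Longrightarrow> act 0 e x i \<noteq> 0" using x by auto
    ultimately have "rank ?Y = d"
      using full_rank_of_stable[of ?Y "nat (a - b)"] \<open>b < a\<close> subsp_image[OF W] by auto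
    then show False using r rank_image by simp
  qed
  show ?thesis using *[OF eq] *[OF eq[symmetric]] by linarith
qed

lemma pt_nonzero: "i < d \<Longrightarrow> pt n i \<noteq> 0"
  by (simp add: pt_def)

text \<open>Base case of the rank induction. For distinct exponents, the combination of the two
  points that cancels coordinate 0 survives in coordinate 1 by nondegeneracy, which gives two
  pivots.\<close>

lemma zeros_subset_singleton:
  assumes U: "subsp U" and r: "rank U \<le> 1" and d: "d > 1"
    and m: "pt (int m) \<in> U" and n: "pt (int n) \<in> U"
  shows "m = n"
proof -
  have *: "\<not> m < n" if m: "pt (int m) \<in> U" and n: "pt (int n) \<in> U" for m n
  proof
    assume "m < n"
    define v where "v = (\<lambda>i. \<alpha> 0 ^ m * pt (int n) i - \<alpha> 0 ^ n * pt (int m) i)"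
    have v: "v \<in> U" unfolding v_def using U m n by (auto intro: subsp_diff subsp_scale)
    have "v 1 = \<alpha> 0 ^ m * \<alpha> 1 ^ m * (\<alpha> 1 ^ (n - m) - \<alpha> 0 ^ (n - m))"
      using d \<open>m < n\<close> by (simp add: v_def pt_def algebra_simps flip: power_add)
    then have v1: "v 1 \<noteq> 0" using nondegenerate[of 1 0 "n - m"] d \<open>m < n\<close> by simp
    have v0: "v 0 = 0" using d by (simp add: v_def pt_def)
    have "{0, 1} \<subseteq> pivots U"
      using d v1 v0 v m pt_nonzero[of 0 "int m"] unfolding pivots_def by auto
    then have "card {0, 1::nat} \<le> rank U" unfolding rank_def by (intro card_mono) auto
    then show False using r by simp
  qed
  show ?thesis using *[OF m n] *[OF n m] by linarith
qed

text \<open>The sets \<open>W m\<close> below increase with \<open>m\<close>, and the bijection \<open>act b e\<close> maps \<open>W (Suc m)\<close> onto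
  \<open>W m\<close>, so they all have the same rank and are equal.\<close>

lemma shift_down:
  assumes U: "subsp U" and q: "q = p ^ e"
    and ev: "\<And>l. l \<ge> l0 \<Longrightarrow> pt (a + b * bracket q l) \<in> U"
  shows "pt (a + b * bracket q l) \<in> U"
proof -
  \<comment> \<open>The hypothesis concerns the single vector \<open>pt 0\<close>. Admitting every
    vector with the same property yields a subspace, to which ranks apply.\<close>
  define W where "W m = {y. (\<forall>i\<ge>d. y i = 0) \<and> (\<forall>l\<ge>m. act (a + b * bracket q l) (e * l) y \<in> U)}" for m
  have sub: "subsp (W m)" for m
    using U unfolding subsp_def W_def by (auto simp: act_add act_scale)
  \<comment> \<open>Applying \<open>act b e\<close> first raises \<open>l\<close> by one, since
    \<open>bracket q (Suc l)\<close> is \<open>bracket q l\<close> plus q^l.\<close>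
  have step: "act b e y \<in> W m \<longleftrightarrow> y \<in> W (Suc m)" for y m
  proof -
    have "act (a + b * bracket q l) (e * l) (act b e y) = act (a + b * bracket q (Suc l)) (e * Suc l) y" for l
      by (simp add: act_act bracket_Suc q algebra_simps flip: power_mult)
    then have "act b e y \<in> W m \<longleftrightarrow>
        (\<forall>i\<ge>d. y i = 0) \<and> (\<forall>l\<ge>m. act (a + b * bracket q (Suc l)) (e * Suc l) y \<in> U)"
      unfolding W_def by simp
    also have "\<dots> \<longleftrightarrow> y \<in> W (Suc m)"
      unfolding W_def all_ge_Suc[of m] by simp
    finally show ?thesis .
  qed
  have "act b e ` W (Suc m) = W m" for m
  proof
    show "W m \<subseteq> act b e ` W (Suc m)"
    proof
      fix v assume "v \<in> W m"
      moreover obtain w where "act b e w = v" using act_surj by blast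
      ultimately show "v \<in> act b e ` W (Suc m)" using step by blast
    qed
  qed (use step in auto)
  then have "rank (W (Suc m)) \<le> rank (W m)" for m
    by (metis order_refl rank_image)
  moreover have "W m \<subseteq> W (Suc m)" for m by (auto simp: W_def)
  ultimately have "W m = W (Suc m)" for m
    using subsp_rank_eq sub by blast
  then have "W m = W 0" for m by (induction m) auto
  moreover have pt0: "act (a + b * bracket q l) (e * l) (pt 0) = pt (a + b * bracket q l)" for l
    by (simp add: act_pt)
  then have "pt 0 \<in> W l0" using ev by (simp add: W_def) (simp add: pt_def)
  ultimately have "pt 0 \<in> W 0" by blast
  then show ?thesis unfolding W_def using pt0 by auto
qed

end

subsection \<open>Coverings by nested pieces\<close>

definition piece_val :: "nat \<Rightarrow> int \<Rightarrow> int list \<Rightarrow> nat list \<Rightarrow> int" where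
  "piece_val q a bs ks = a + (\<Sum>i<length bs. bs ! i * bracket q (ks ! i))"

lemma piece_val_Nil [simp]: "piece_val q a [] ks = a"
  by (simp add: piece_val_def)

lemma piece_val_Cons [simp]:
  "piece_val q a (b # bs) (k # ks) = piece_val q (a + b * bracket q k) bs ks"
  by (simp only: piece_val_def length_Cons sum.lessThan_Suc_shift) simp

lemma piece_val_add: "piece_val q (a + c) bs ks = piece_val q a bs ks + c"
  by (simp add: piece_val_def)

lemma piece_val_scale: "r * piece_val q a bs ks = piece_val q (r * a) (map ((*) r) bs) ks"
  by (simp add: piece_val_def algebra_simps sum_distrib_left)

text \<open>The map n to q n + J, applied \<open>m\<close> times to a piece, raises all exponents by
  \<open>m\<close> and creates one new term with exponent \<open>m\<close>. This follows from q^m =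
  1 + (q - 1) \<open>bracket q m\<close> and q^m \<open>bracket q k\<close> =
  \<open>bracket q (k + m)\<close> - \<open>bracket q m\<close>.\<close>

lemma piece_val_shift:
  assumes "length ks = length bs"
  shows "int q ^ m * piece_val q a bs ks + J * bracket q m =
    piece_val q (a + ((int q - 1) * a + J - sum_list bs) * bracket q m) bs (map (\<lambda>k. k + m) ks)"
  using assms
proof (induction bs arbitrary: a ks)
  case Nil
  have "int q ^ m = (int q - 1) * bracket q m + 1" by (simp add: bracket_mult)
  then have "int q ^ m * a + J * bracket q m = ((int q - 1) * bracket q m + 1) * a + J * bracket q m"
    by simp
  also have "\<dots> = a + ((int q - 1) * a + J) * bracket q m" by (simp only: algebra_simps)
  finally have "int q ^ m * a + J * bracket q m = a + ((int q - 1) * a + J) * bracket q m" .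
  then show ?case by simp
next
  case (Cons b bs)
  obtain k ks' where ks: "ks = k # ks'" "length ks' = length bs"
    using Cons.prems by (cases ks) auto
  let ?B = "bracket q m"
  have "a + b * bracket q k + ((int q - 1) * (a + b * bracket q k) + J - sum_list bs) * ?B
      = a + ((int q - 1) * a + J - sum_list (b # bs)) * ?B + b * (bracket q k + ((int q - 1) * bracket q k + 1) * ?B)"
    by (simp add: algebra_simps)
  also have "bracket q k + ((int q - 1) * bracket q k + 1) * ?B = bracket q (k + m)"
    using bracket_add[of q m k] by (simp add: bracket_mult add.commute)
  finally have eq: "a + b * bracket q k + ((int q - 1) * (a + b * bracket q k) + J - sum_list bs) * ?B
      = a + ((int q - 1) * a + J - sum_list (b # bs)) * ?B + b * bracket q (k + m)" .
  show ?case
    unfolding ks(1) piece_val_Cons list.map Cons.IH[OF ks(2)] eq ..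
qed

context frobenius_diagonal
begin

definition Z :: "(nat \<Rightarrow> 'b) set \<Rightarrow> nat set" where
  "Z U = {n. pt (int n) \<in> U}"

text \<open>The condition covers negative values of the piece too, which is why \<open>pt\<close>
  takes integers: \<open>shift_down\<close> can then be applied without regard to signs.\<close>

definition piece_ok :: "nat \<Rightarrow> (nat \<Rightarrow> 'b) set \<Rightarrow> nat \<Rightarrow> int \<Rightarrow> int list \<Rightarrow> bool" where
  "piece_ok q U k a bs \<longleftrightarrow> length bs \<le> k \<and> 0 \<notin> set bs \<and>
     (\<forall>ks. length ks = length bs \<longrightarrow> pt (piece_val q a bs ks) \<in> U)"

text \<open>The pieces may overshoot \<open>N\<close> but must stay in \<open>U\<close>. A covering
  of \<open>Z U\<close> therefore describes it exactly, while the pieces used for a part of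
  \<open>Z U\<close> can be enlarged freely within \<open>U\<close>.\<close>

definition covers :: "nat \<Rightarrow> (nat \<Rightarrow> 'b) set \<Rightarrow> nat set \<Rightarrow> nat \<Rightarrow> (int \<times> int list) set \<Rightarrow> bool" where
  "covers q U N k D \<longleftrightarrow> finite D \<and> (\<forall>a bs. (a, bs) \<in> D \<longrightarrow> piece_ok q U k a bs) \<and>
     (\<forall>n\<in>N. \<exists>a bs ks. (a, bs) \<in> D \<and> length ks = length bs \<and> int n = piece_val q a bs ks)"

definition cov :: "nat \<Rightarrow> (nat \<Rightarrow> 'b) set \<Rightarrow> nat set \<Rightarrow> nat \<Rightarrow> bool" where
  "cov q U N k \<longleftrightarrow> (\<exists>D. covers q U N k D)"

lemma covI:
  assumes "finite D" "\<And>a bs. (a, bs) \<in> D \<Longrightarrow> piece_ok q U k a bs"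
    and "\<And>n. n \<in> N \<Longrightarrow> \<exists>a bs ks. (a, bs) \<in> D \<and> length ks = length bs \<and> int n = piece_val q a bs ks"
  shows "cov q U N k"
  unfolding cov_def covers_def using assms by (intro exI[of _ D] conjI allI impI ballI)

lemma coversD:
  assumes "covers q U N k D"
  shows "finite D" "(a, bs) \<in> D \<Longrightarrow> piece_ok q U k a bs"
    "n \<in> N \<Longrightarrow> \<exists>a bs ks. (a, bs) \<in> D \<and> length ks = length bs \<and> int n = piece_val q a bs ks"
  using assms unfolding covers_def by auto

lemma cov_mono:
  assumes "cov q U N k" "N' \<subseteq> N" "k \<le> k'"
  shows "cov q U N' k'"
proof -
  have "piece_ok q U k a bs \<Longrightarrow> piece_ok q U k' a bs" for a bs
    using assms(3) by (auto simp: piece_ok_def)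
  then show ?thesis using assms(1,2) unfolding cov_def covers_def by (meson subsetD)
qed

lemma cov_Un:
  assumes "cov q U N k" "cov q U N' k"
  shows "cov q U (N \<union> N') k"
proof -
  obtain D D' where "covers q U N k D" "covers q U N' k D'" using assms by (auto simp: cov_def)
  note D = coversD[OF this(1)] and D' = coversD[OF this(2)]
  show ?thesis by (rule covI[of "D \<union> D'"]) (use D D' in blast)+
qed

lemma cov_finite:
  assumes "finite N" "N \<subseteq> Z U"
  shows "cov q U N k"
proof (rule covI[of "(\<lambda>n. (int n, [])) ` N"])
  fix n assume "n \<in> N"
  then have "(int n, []) \<in> (\<lambda>n. (int n, [])) ` N" by blast
  then show "\<exists>a bs ks. (a, bs) \<in> (\<lambda>n. (int n, [])) ` N \<and> length ks = length bs \<and>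
      int n = piece_val q a bs ks"
    by (metis length_0_conv piece_val_Nil)
qed (use assms in \<open>auto simp: Z_def piece_ok_def\<close>)

lemma cov_UN:
  assumes "finite I" "\<And>i. i \<in> I \<Longrightarrow> cov q U (N i) k"
  shows "cov q U (\<Union>i\<in>I. N i) k"
  using assms
proof (induction I rule: finite_induct)
  case empty
  then show ?case by (simp add: cov_finite)
qed (auto intro: cov_Un)

lemma cov_lift:
  assumes cov: "cov q U' N k" and sub: "act (int j) e ` U' \<subseteq> U"
  shows "cov q U ((\<lambda>n. p ^ e * n + j) ` N) k"
proof -
  obtain D where "covers q U' N k D" using cov by (auto simp: cov_def)
  note D = coversD[OF this]
  let ?r = "int p ^ e"
  define f where "f = (\<lambda>(a, bs). (?r * a + int j, map ((*) ?r) bs))"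
  have val: "piece_val q (?r * a + int j) (map ((*) ?r) bs) ks = int j + ?r * piece_val q a bs ks"
    for a bs ks
    by (simp add: piece_val_add piece_val_scale)
  have pts: "pt (int j + ?r * n) \<in> U" if "pt n \<in> U'" for n
    using sub that act_pt by (metis image_subset_iff)
  show ?thesis
  proof (rule covI[of "f ` D"])
    show "finite (f ` D)" using D by simp
    fix a bs assume "(a, bs) \<in> f ` D"
    then obtain a' bs' where *: "(a', bs') \<in> D" "a = ?r * a' + int j" "bs = map ((*) ?r) bs'"
      by (auto simp: f_def)
    show "piece_ok q U k a bs"
      using D(2)[OF *(1)] p_pos by (auto simp: piece_ok_def * val intro: pts)
  next
    fix n assume "n \<in> (\<lambda>n. p ^ e * n + j) ` N"
    then obtain x where x: "x \<in> N" "n = p ^ e * x + j" by blast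
    then obtain a bs ks where *: "(a, bs) \<in> D" "length ks = length bs" "int x = piece_val q a bs ks"
      using D(3) by blast
    have "int n = piece_val q (?r * a + int j) (map ((*) ?r) bs) ks"
      using x * by (simp add: val)
    moreover have "(?r * a + int j, map ((*) ?r) bs) \<in> f ` D"
      using *(1) by (force simp: f_def)
    ultimately show "\<exists>a bs ks. (a, bs) \<in> f ` D \<and> length ks = length bs \<and> int n = piece_val q a bs ks"
      using *(2) by (metis length_map)
  qed
qed

text \<open>The exponents are freed one at a time: with the first one fixed, induction frees the
  others, and then \<open>shift_down\<close> frees the first.\<close>

lemma pieces_shift_down:
  assumes U: "subsp U" and q: "q = p ^ e" and "length ls = length bs"
    and "\<And>ls. length ls = length bs \<Longrightarrow> (\<forall>l\<in>set ls. m \<le> l) \<Longrightarrow> pt (piece_val q a bs ls) \<in> U"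
  shows "pt (piece_val q a bs ls) \<in> U"
  using assms(3,4)
proof (induction bs arbitrary: a ls)
  case Nil
  then show ?case by simp
next
  case (Cons b bs)
  obtain l ls' where ls: "ls = l # ls'" "length ls' = length bs"
    using Cons.prems(1) by (cases ls) auto
  have eq: "piece_val q a (b # bs) (l # ls') = piece_val q a bs ls' + b * bracket q l" for l
    by (simp add: piece_val_add)
  have "pt (piece_val q a bs ls' + b * bracket q l) \<in> U" if "l \<ge> m" for l
    unfolding eq[symmetric] piece_val_Cons
  proof (rule Cons.IH[OF ls(2)])
    fix ls assume "length ls = length bs" "\<forall>l\<in>set ls. m \<le> l"
    then show "pt (piece_val q (a + b * bracket q l) bs ls) \<in> U"
      using Cons.prems(2)[of "l # ls"] that by simp
  qed
  then show ?case unfolding ls eq by (rule shift_down[OF U q])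
qed

text \<open>By \<open>piece_val_shift\<close>, running the cycle \<open>m\<close> times on a piece
  gives a term with exponent \<open>m\<close> and old exponents that are at least \<open>m\<close>.
  Since \<open>U\<close> is stable under the cycle, these values stay in \<open>U\<close>, and
  \<open>pieces_shift_down\<close> then removes the lower bound, so \<open>m\<close> becomes an
  independent exponent.\<close>

lemma cov_cycle:
  assumes U: "subsp U" and q: "q = p ^ e" and stable: "act J e ` U \<subseteq> U"
    and cov: "cov q U N k"
  shows "cov q U {n. \<exists>m. \<exists>x\<in>N. int n = int q ^ m * int x + J * bracket q m} (Suc k)"
proof -
  obtain D where "covers q U N k D" using cov by (auto simp: cov_def)
  note D = coversD[OF this]
  define b0 where "b0 a bs = (int q - 1) * a + J - sum_list bs" for a bs
  \<comment> \<open>A zero coefficient is not allowed in a piece; in that case \<open>m\<close> has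
    no effect on the value and no exponent is added.\<close>
  define ext where "ext = (\<lambda>(a, bs). (a, if b0 a bs = 0 then bs else b0 a bs # bs))"
  have iter: "pt (int q ^ m * n + J * bracket q m) \<in> U" if "pt n \<in> U" for m n
  proof (induction m)
    case (Suc m)
    have "act J e (pt (int q ^ m * n + J * bracket q m)) \<in> U" using Suc stable by blast
    then show ?case by (simp add: act_pt q bracket_Suc' algebra_simps)
  qed (use that in simp)
  have valid: "pt (piece_val q (a + b0 a bs * bracket q m) bs ls) \<in> U"
    if abs: "(a, bs) \<in> D" and "length ls = length bs" for a bs m ls
  proof (rule pieces_shift_down[OF U q that(2), of m])
    fix ls assume ls: "length ls = length bs" "\<forall>l\<in>set ls. m \<le> l"
    define ks where "ks = map (\<lambda>l. l - m) ls"
    have "map (\<lambda>k. k + m) ks = ls" unfolding ks_def using ls(2) by (auto simp: map_idI)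
    moreover have len: "length ks = length bs" using ls by (simp add: ks_def)
    moreover have "pt (piece_val q a bs ks) \<in> U" using D(2)[OF abs] len by (auto simp: piece_ok_def)
    ultimately show "pt (piece_val q (a + b0 a bs * bracket q m) bs ls) \<in> U"
      using iter[of "piece_val q a bs ks" m] by (simp add: piece_val_shift b0_def)
  qed
  show ?thesis
  proof (rule covI[of "ext ` D"])
    show "finite (ext ` D)" using D by simp
    fix a bs' assume "(a, bs') \<in> ext ` D"
    then obtain bs where *: "(a, bs) \<in> D" "bs' = (if b0 a bs = 0 then bs else b0 a bs # bs)"
      by (auto simp: ext_def)
    show "piece_ok q U (Suc k) a bs'"
      using D(2)[OF *(1)] valid[OF *(1)] by (auto simp: piece_ok_def *(2) length_Suc_conv)
  next
    fix n assume "n \<in> {n. \<exists>m. \<exists>x\<in>N. int n = int q ^ m * int x + J * bracket q m}"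
    then obtain m x where mx: "x \<in> N" "int n = int q ^ m * int x + J * bracket q m" by blast
    then obtain a bs ks where *: "(a, bs) \<in> D" "length ks = length bs" "int x = piece_val q a bs ks"
      using D(3) by blast
    let ?ls = "map (\<lambda>k. k + m) ks"
    have n: "int n = piece_val q (a + b0 a bs * bracket q m) bs ?ls"
      using mx * by (simp add: piece_val_shift b0_def)
    have "(a, if b0 a bs = 0 then bs else b0 a bs # bs) \<in> ext ` D"
      using *(1) by (force simp: ext_def)
    moreover have "length (if b0 a bs = 0 then ?ls else m # ?ls) =
        length (if b0 a bs = 0 then bs else b0 a bs # bs)"
      using * by simp
    moreover have "int n = piece_val q a (if b0 a bs = 0 then bs else b0 a bs # bs)
        (if b0 a bs = 0 then ?ls else m # ?ls)"
      using n by simp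
    ultimately show "\<exists>a bs ks. (a, bs) \<in> ext ` D \<and> length ks = length bs \<and> int n = piece_val q a bs ks"
      by blast
  qed
qed

end

subsection \<open>The automaton of subspaces\<close>

text \<open>Reading the digit \<open>j\<close> leads from \<open>U\<close> to \<open>T U j\<close>.
  This state lies inside the preimage of \<open>U\<close> under \<open>act j 1\<close> and contains
  the relevant points \<open>pt n\<close>; the slack leaves room to choose it from a finite
  set.\<close>

locale frobenius_automaton = frobenius_diagonal \<alpha> d p
  for \<alpha> :: "nat \<Rightarrow> 'b::field" and d p +
  fixes S :: "(nat \<Rightarrow> 'b) set set" and T :: "(nat \<Rightarrow> 'b) set \<Rightarrow> nat \<Rightarrow> (nat \<Rightarrow> 'b) set"
  assumes finite_S: "finite S"
    and subsp_S: "\<And>U. U \<in> S \<Longrightarrow> subsp U"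
    and T_in_S: "\<And>U j. U \<in> S \<Longrightarrow> j < p \<Longrightarrow> T U j \<in> S"
    and act_T: "\<And>U j. U \<in> S \<Longrightarrow> j < p \<Longrightarrow> act (int j) 1 ` T U j \<subseteq> U"
    and pt_T: "\<And>U j n. U \<in> S \<Longrightarrow> j < p \<Longrightarrow> pt (int (p * n + j)) \<in> U \<Longrightarrow> pt (int n) \<in> T U j"
begin

text \<open>The state after the \<open>e\<close> lowest base-\<open>p\<close> digits of
  \<open>n\<close>, the least significant read first.\<close>

primrec tr :: "nat \<Rightarrow> nat \<Rightarrow> (nat \<Rightarrow> 'b) set \<Rightarrow> (nat \<Rightarrow> 'b) set" where
  "tr 0 n U = U"
| "tr (Suc e) n U = tr e (n div p) (T U (n mod p))"

lemma mod_p_less: "n mod p < p"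
  using p_pos by simp

lemma tr_in_S: "U \<in> S \<Longrightarrow> tr e n U \<in> S"
  by (induction e arbitrary: n U) (auto simp: T_in_S mod_p_less)

lemma tr_add: "tr (e + f) n U = tr f (n div p ^ e) (tr e n U)"
  by (induction e arbitrary: n U) (auto simp: div_mult2_eq)

lemma tr_mod: "tr e (n mod p ^ e) U = tr e n U"
proof (induction e arbitrary: n U)
  case (Suc e)
  have "(n mod p ^ Suc e) div p = n div p mod p ^ e" "(n mod p ^ Suc e) mod p = n mod p"
    unfolding nat_power_mod_split using p_pos by simp_all
  then show ?case using Suc[of "n div p"] by simp
qed auto

lemma act_tr: "U \<in> S \<Longrightarrow> act (int (n mod p ^ e)) e ` tr e n U \<subseteq> U"
proof (induction e arbitrary: n U)
  case 0
  then show ?case by (auto simp: act_def)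
next
  case (Suc e)
  let ?V = "T U (n mod p)"
  have "act (int (n mod p ^ Suc e)) (Suc e) ` tr (Suc e) n U =
      act (int (n mod p)) 1 ` act (int (n div p mod p ^ e)) e ` tr e (n div p) ?V"
    unfolding act_image_act_image nat_power_mod_split by simp
  also have "\<dots> \<subseteq> act (int (n mod p)) 1 ` ?V"
    using Suc T_in_S mod_p_less by (intro image_mono) blast
  also have "\<dots> \<subseteq> U" using act_T Suc.prems mod_p_less by blast
  finally show ?case .
qed

lemma Z_tr: "U \<in> S \<Longrightarrow> n \<in> Z U \<Longrightarrow> n div p ^ e \<in> Z (tr e n U)"
proof (induction e arbitrary: n U)
  case (Suc e)
  have "pt (int (p * (n div p) + n mod p)) \<in> U" using Suc.prems by (simp add: Z_def)
  then have "n div p \<in> Z (T U (n mod p))"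
    using pt_T Suc.prems mod_p_less by (simp only: Z_def mem_Collect_eq)
  then show ?case
    using Suc.IH[of "T U (n mod p)" "n div p"] T_in_S Suc.prems mod_p_less
    by (simp add: div_mult2_eq)
qed simp

lemma rank_tr_le: "U \<in> S \<Longrightarrow> rank (tr e n U) \<le> rank U"
  using rank_le_of_act_subset act_tr by blast

lemma act_tr_eq: "U \<in> S \<Longrightarrow> rank (tr e n U) = rank U \<Longrightarrow> act (int (n mod p ^ e)) e ` tr e n U = U"
  by (intro act_image_eq_of_rank act_tr subsp_S tr_in_S) auto

section \<open>Recurring states and their forced digits\<close>

definition cyclic :: "(nat \<Rightarrow> 'b) set \<Rightarrow> bool" where
  "cyclic U \<longleftrightarrow> (\<exists>e n. 1 \<le> e \<and> e \<le> card S \<and> tr e n U = U)"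

text \<open>Pigeonhole: the states after 0, ..., \<open>card S\<close> digits cannot all be
  distinct.\<close>

lemma eventually_cyclic:
  assumes "U \<in> S"
  obtains s where "s \<le> card S" "cyclic (tr s n U)"
proof -
  have "card ((\<lambda>s. tr s n U) ` {..card S}) \<le> card S"
    by (rule card_mono[OF finite_S]) (auto intro: tr_in_S[OF assms])
  then have "\<not> inj_on (\<lambda>s. tr s n U) {..card S}"
    by (auto dest: card_image)
  then obtain s t where st: "s < t" "t \<le> card S" "tr s n U = tr t n U"
    unfolding inj_on_def by (metis atMost_iff nat_neq_iff)
  have "tr (t - s) (n div p ^ s) (tr s n U) = tr s n U"
    using tr_add[of s "t - s" n U] st by simp
  moreover have "1 \<le> t - s" "t - s \<le> card S" using st by auto
  ultimately have "cyclic (tr s n U)" unfolding cyclic_def by blast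
  moreover have "s \<le> card S" using st by simp
  ultimately show ?thesis by (rule that[rotated])
qed

text \<open>Every cyclic state has a period of at most \<open>card S\<close>, which divides this factorial.\<close>

definition period :: nat where "period = fact (card S)"

lemma period_pos: "period > 0"
  by (simp add: period_def)

lemma cyclic_period:
  assumes "cyclic U"
  obtains J where "J < p ^ period" "tr period J U = U"
proof -
  obtain e n where e: "1 \<le> e" "e \<le> card S" "tr e n U = U"
    using assms by (auto simp: cyclic_def)
  then have "e dvd period" unfolding period_def by (intro dvd_fact)
  then obtain t where t: "period = e * t" by blast
  have "\<exists>J. tr (e * t) J U = U" for t
  proof (induction t)
    case (Suc t)
    then obtain J where J: "tr (e * t) J U = U" by blast
    \<comment> \<open>The digit word of the loop, followed by the word of \<open>J\<close>.\<close>
    let ?n = "n mod p ^ e + p ^ e * J"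
    have "tr e ?n U = U"
      using e tr_mod[of e ?n U] tr_mod[of e n U] by simp
    moreover have "?n div p ^ e = J" using p_pos by simp
    ultimately have "tr (e * Suc t) ?n U = U" using J tr_add[of e "e * t" ?n U] by simp
    then show ?case by blast
  qed auto
  from this[of t] obtain J where "tr period J U = U" unfolding t by blast
  then show ?thesis using that[of "J mod p ^ period"] tr_mod p_pos by simp
qed

text \<open>From a cyclic state, the digits of any path that leads to a cyclic state of the same rank
  are forced: otherwise two different translates of the same subspace would coincide.\<close>

lemma cyclic_digit_unique:
  assumes U: "U \<in> S" and cyc: "tr period J U = U" "J < p ^ period"
    and f: "period \<le> f" and cyc': "cyclic (tr f m U)"
    and rank: "rank (tr f m U) = rank U" "rank U < d" and Z: "Z (tr f m U) \<noteq> {}"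
  shows "m mod p ^ period = J"
proof -
  let ?V = "tr f m U" and ?q = "int p ^ period" and ?m = "int (m mod p ^ f)"
  obtain I where I: "I < p ^ period" "tr period I ?V = ?V" using cyclic_period[OF cyc'] .
  have V: "?V \<in> S" using U by (rule tr_in_S)
  have e1: "act J period ` U = U" using act_tr_eq[OF U, of period J] cyc by simp
  have e2: "act I period ` ?V = ?V" using act_tr_eq[OF V, of period I] I by simp
  have e3: "act ?m f ` ?V = U" using act_tr_eq[OF U, of f m] rank by simp
  \<comment> \<open>Going round the loop at \<open>U\<close> before the path, or round the loop at
    \<open>?V\<close> after it, maps \<open>?V\<close> onto \<open>U\<close> with the same Frobenius
    exponent. The diagonal exponents must then agree.\<close>
  have "act (int J + ?q * ?m) (period + f) ` ?V = U"
    using e1 e3 by (simp add: act_image_act_image[symmetric])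
  moreover have "act (?m + int p ^ f * int I) (f + period) ` ?V = U"
    using e2 e3 by (simp add: act_image_act_image[symmetric])
  moreover obtain n where "pt (int n) \<in> ?V" using Z by (auto simp: Z_def)
  ultimately have eq: "int J + ?q * ?m = ?m + int p ^ f * int I"
    using act_image_inject[OF subsp_S[OF V], of "pt (int n)" _ "period + f"] rank pt_nonzero
    by (simp add: add.commute)
  \<comment> \<open>As \<open>period \<le> f\<close>, comparing the two exponents modulo
    \<open>p ^ period\<close> leaves \<open>J\<close> on one side and the first
    \<open>period\<close> digits of \<open>m\<close> on the other.\<close>
  have "p ^ f = p ^ period * p ^ (f - period)" using f by (simp flip: power_add)
  then have "int J + ?q * ?m = ?m + ?q * (int p ^ (f - period) * int I)"
    using eq by (simp flip: of_nat_power)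
  then have "J + p ^ period * (m mod p ^ f) = m mod p ^ f + p ^ period * (p ^ (f - period) * I)"
    by (simp flip: of_nat_power of_nat_mult of_nat_add del: of_nat_mod)
  then have "J mod p ^ period = (m mod p ^ f) mod p ^ period"
    by (metis mod_mult_self2)
  also have "\<dots> = m mod p ^ period" using f by (simp add: le_imp_power_dvd mod_mod_cancel)
  finally show ?thesis using cyc by simp
qed

text \<open>Every zero meets a cyclic state within \<open>card S\<close> digits, where the rank has
  dropped below \<open>k\<close> and cannot rise again. Splitting by the residue modulo
  \<open>p ^ card S\<close> reduces to finitely many states of smaller rank without adding
  exponents.\<close>

lemma cov_of_no_cyclic:
  assumes U: "U \<in> S"
    and IH: "\<And>U. U \<in> S \<Longrightarrow> rank U < k \<Longrightarrow> cov q U (Z U) c"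
    and no_cyclic: "\<And>s n. n \<in> Z U \<Longrightarrow> cyclic (tr s n U) \<Longrightarrow> rank (tr s n U) < k"
  shows "cov q U (Z U) c"
proof -
  let ?N = "card S"
  let ?I = "{j. j < p ^ ?N \<and> rank (tr ?N j U) < k}"
  have "cov q U (\<Union>j\<in>?I. (\<lambda>n. p ^ ?N * n + j) ` Z (tr ?N j U)) c"
  proof (rule cov_UN)
    fix j assume "j \<in> ?I"
    then show "cov q U ((\<lambda>n. p ^ ?N * n + j) ` Z (tr ?N j U)) c"
      using act_tr[OF U, of j ?N] by (intro cov_lift[OF IH]) (auto simp: tr_in_S U)
  qed auto
  moreover have "Z U \<subseteq> (\<Union>j\<in>?I. (\<lambda>n. p ^ ?N * n + j) ` Z (tr ?N j U))"
  proof
    fix n assume n: "n \<in> Z U"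
    obtain s where s: "s \<le> ?N" "cyclic (tr s n U)" using eventually_cyclic[OF U] .
    have "tr ?N n U = tr (?N - s) (n div p ^ s) (tr s n U)"
      using tr_add[of s "?N - s" n U] s by simp
    then have "rank (tr ?N n U) \<le> rank (tr s n U)" using rank_tr_le tr_in_S U by simp
    also have "\<dots> < k" using no_cyclic n s by blast
    finally have "n mod p ^ ?N \<in> ?I" using tr_mod[of ?N n U] p_pos by simp
    moreover have "n = p ^ ?N * (n div p ^ ?N) + n mod p ^ ?N" by simp
    moreover have "n div p ^ ?N \<in> Z (tr ?N (n mod p ^ ?N) U)"
      using Z_tr[OF U n, of ?N] tr_mod[of ?N n U] by simp
    ultimately show "n \<in> (\<Union>j\<in>?I. (\<lambda>n. p ^ ?N * n + j) ` Z (tr ?N j U))" by blast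
  qed
  ultimately show ?thesis by (rule cov_mono) simp
qed

text \<open>A zero follows the loop of \<open>U\<close> some number of times and then leaves it,
  unless it ends at 0. After leaving, no cyclic state of the same rank can be met, so the zeros in
  \<open>B\<close> need only the exponents for smaller rank; the number of turns is the extra
  one.\<close>

lemma cov_of_cyclic:
  assumes U: "U \<in> S" and cyc: "cyclic U" and d: "rank U < d"
    and IH: "\<And>V. V \<in> S \<Longrightarrow> rank V < rank U \<Longrightarrow> cov (p ^ period) V (Z V) c"
  shows "cov (p ^ period) U (Z U) (Suc c)"
proof -
  let ?q = "p ^ period"
  obtain J where J: "J < ?q" "tr period J U = U" using cyclic_period[OF cyc] .
  have q2: "?q > 1" using p_ge_2 period_pos by (intro one_less_power) auto
  define B where "B = {n \<in> Z U. n mod ?q \<noteq> J}"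
  let ?I = "{j. j < ?q \<and> j \<noteq> J}"
  have "cov ?q U (\<Union>j\<in>?I. (\<lambda>n. ?q * n + j) ` Z (tr period j U)) c"
  proof (rule cov_UN)
    fix j assume j: "j \<in> ?I"
    have tr: "tr period j U \<in> S" by (rule tr_in_S[OF U])
    have "cov ?q (tr period j U) (Z (tr period j U)) c"
    proof (rule cov_of_no_cyclic[OF tr, of "rank U"])
      fix s n assume n: "n \<in> Z (tr period j U)" and c: "cyclic (tr s n (tr period j U))"
      let ?m = "j + ?q * n"
      have m: "?m mod ?q = j" "?m div ?q = n" using j p_pos by auto
      then have eq: "tr s n (tr period j U) = tr (period + s) ?m U"
        using tr_add[of period s ?m U] tr_mod[of period ?m U] by simp
      have ne: "Z (tr (period + s) ?m U) \<noteq> {}"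
        using Z_tr[OF tr n, of s] unfolding eq by blast
      show "rank (tr s n (tr period j U)) < rank U"
      proof (rule ccontr)
        assume "\<not> rank (tr s n (tr period j U)) < rank U"
        then have "rank (tr (period + s) ?m U) = rank U"
          using rank_tr_le[OF U, of "period + s" ?m] unfolding eq by simp
        then have "?m mod ?q = J"
          using cyclic_digit_unique[OF U J(2,1) _ _ _ d ne] c unfolding eq by simp
        then show False using m j by simp
      qed
    qed (use IH in auto)
    then show "cov ?q U ((\<lambda>n. ?q * n + j) ` Z (tr period j U)) c"
      using act_tr[OF U, of j period] j by (intro cov_lift) auto
  qed auto
  moreover have "B \<subseteq> (\<Union>j\<in>?I. (\<lambda>n. ?q * n + j) ` Z (tr period j U))"
  proof
    fix n assume n: "n \<in> B"
    have "n mod ?q \<in> ?I" using n p_pos by (simp add: B_def)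
    moreover have "n = ?q * (n div ?q) + n mod ?q" by simp
    moreover have "n div ?q \<in> Z (tr period (n mod ?q) U)"
      using Z_tr[OF U, of n period] tr_mod[of period n U] n by (simp add: B_def)
    ultimately show "n \<in> (\<Union>j\<in>?I. (\<lambda>n. ?q * n + j) ` Z (tr period j U))" by blast
  qed
  ultimately have covB: "cov ?q U B c" by (rule cov_mono) simp
  let ?C = "{n. \<exists>m. \<exists>x\<in>B. int n = int ?q ^ m * int x + int J * bracket ?q m}"
  have "act (int J) period ` U \<subseteq> U" using act_tr[OF U, of J period] J by simp
  then have "cov ?q U ?C (Suc c)"
    using cov_cycle[OF subsp_S[OF U] refl _ covB] by blast
  \<comment> \<open>If \<open>J = 0\<close>, the number 0 is fixed by the cycle and lies outside
    \<open>B\<close>, so it is covered separately.\<close>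
  moreover have "cov ?q U ({0} \<inter> Z U) (Suc c)" by (rule cov_finite) auto
  ultimately have "cov ?q U (?C \<union> {0} \<inter> Z U) (Suc c)" by (rule cov_Un)
  moreover have "n \<in> ?C \<union> {0} \<inter> Z U" if "n \<in> Z U" for n
    using that
  proof (induction n rule: less_induct)
    case (less n)
    have inC: "n \<in> ?C" if "n \<in> B" for n
      using that by (intro CollectI exI[of _ 0] bexI[of _ n]) auto
    consider "n = 0" | "n \<in> B" | "n > 0" "n mod ?q = J"
      using less.prems by (auto simp: B_def)
    then show ?case
    proof cases
      case 3
      let ?n = "n div ?q"
      have n: "n = ?q * ?n + J" using 3 by (metis div_mult_mod_eq mult.commute)
      have "?n \<in> Z U" using Z_tr[OF U less.prems, of period] tr_mod[of period n U] 3 J by simp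
      moreover have "?n < n" using 3 q2 by (simp add: div_less_dividend)
      ultimately have "?n \<in> ?C \<union> {0} \<inter> Z U" using less.IH by blast
      \<comment> \<open>Here \<open>n = J > 0\<close>, so the digits of 0 differ from those of the
        loop and 0 lies in \<open>B\<close>.\<close>
      moreover have "?n \<in> ?C" if "?n = 0"
      proof (rule inC)
        show "?n \<in> B" using that n 3 \<open>?n \<in> Z U\<close> by (auto simp: B_def)
      qed
      ultimately have "?n \<in> ?C" by blast
      then obtain m x where "x \<in> B" "int ?n = int ?q ^ m * int x + int J * bracket ?q m" by blast
      moreover have "int n = int ?q * int ?n + int J"
        using n by (metis of_nat_add of_nat_mult)
      ultimately have "x \<in> B" "int n = int ?q ^ Suc m * int x + int J * bracket ?q (Suc m)"
        by (simp_all add: bracket_Suc' algebra_simps)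
      then show ?thesis by blast
    qed (use less.prems inC in auto)
  qed
  then have "Z U \<subseteq> ?C \<union> {0} \<inter> Z U" by (rule subsetI)
  ultimately show ?thesis by (rule cov_mono) (rule order_refl)
qed

text \<open>Rank \<open>k + 1\<close> costs \<open>k\<close> exponents: rank one leaves at most one
  zero, and each higher rank adds at most one cycle. A general state is first split by its initial
  digits, up to the first \<open>card S\<close>, until the state is cyclic. Rank below
  \<open>d\<close> is what makes the digits of loops unique.\<close>

theorem cov_Z: "U \<in> S \<Longrightarrow> rank U \<le> Suc k \<Longrightarrow> Suc k < d \<Longrightarrow> cov (p ^ period) U (Z U) k"
proof (induction k arbitrary: U)
  case 0
  have "n = m" if "n \<in> Z U" "m \<in> Z U" for n m
    using that zeros_subset_singleton[OF subsp_S, of U n m] 0 by (auto simp: Z_def)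
  then have "finite (Z U)"
    by (metis finite.simps finite_subset insertI1 subsetI)
  then show ?case by (intro cov_finite) auto
next
  case (Suc k)
  have cyc: "cov (p ^ period) V (Z V) (Suc k)" if V: "V \<in> S" "rank V \<le> Suc (Suc k)" "cyclic V" for V
  proof (rule cov_of_cyclic)
    fix V' assume "V' \<in> S" "rank V' < rank V"
    then show "cov (p ^ period) V' (Z V') k" using V Suc by auto
  qed (use V Suc in auto)
  let ?I = "SIGMA s:{..card S}. {j. j < p ^ s \<and> cyclic (tr s j U)}"
  have "cov (p ^ period) U (\<Union>(s, j)\<in>?I. (\<lambda>n. p ^ s * n + j) ` Z (tr s j U)) (Suc k)"
  proof (rule cov_UN)
    show "finite ?I" by auto
    fix x assume "x \<in> ?I"
    then obtain s j where x: "x = (s, j)" "j < p ^ s" "cyclic (tr s j U)" by auto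
    have "cov (p ^ period) (tr s j U) (Z (tr s j U)) (Suc k)"
      using x rank_tr_le[OF Suc.prems(1), of s j] Suc.prems
      by (intro cyc) (auto simp: tr_in_S)
    then show "cov (p ^ period) U (case x of (s, j) \<Rightarrow> (\<lambda>n. p ^ s * n + j) ` Z (tr s j U)) (Suc k)"
      using act_tr[OF Suc.prems(1), of j s] x by (auto intro: cov_lift)
  qed
  moreover have "Z U \<subseteq> (\<Union>(s, j)\<in>?I. (\<lambda>n. p ^ s * n + j) ` Z (tr s j U))"
  proof
    fix n assume n: "n \<in> Z U"
    obtain s where s: "s \<le> card S" "cyclic (tr s n U)" using eventually_cyclic[OF Suc.prems(1)] .
    then have "(s, n mod p ^ s) \<in> ?I" using tr_mod[of s n U] p_pos by simp
    moreover have "n = p ^ s * (n div p ^ s) + n mod p ^ s" by simp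
    moreover have "n div p ^ s \<in> Z (tr s (n mod p ^ s) U)"
      using Z_tr[OF Suc.prems(1) n, of s] tr_mod[of s n U] by simp
    ultimately show "n \<in> (\<Union>(s, j)\<in>?I. (\<lambda>n. p ^ s * n + j) ` Z (tr s j U))" by blast
  qed
  ultimately show ?case by (rule cov_mono) simp
qed

end

subsection \<open>Finiteness of the set of subspaces\<close>

text \<open>In a field of positive characteristic this is the linear span over the prime
  field.\<close>

inductive_set nspan :: "'b::comm_semiring_1 set \<Rightarrow> 'b set" for M where
  zero: "0 \<in> nspan M"
| add: "m \<in> M \<Longrightarrow> y \<in> nspan M \<Longrightarrow> m + y \<in> nspan M"

lemma nspan_base: "m \<in> M \<Longrightarrow> m \<in> nspan M"
  using nspan.add[OF _ nspan.zero] by force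

lemma nspan_mono: "M \<subseteq> N \<Longrightarrow> y \<in> nspan M \<Longrightarrow> y \<in> nspan N"
  by (rotate_tac, induction rule: nspan.induct) (auto intro: nspan.intros)

lemma nspan_add: "x \<in> nspan M \<Longrightarrow> y \<in> nspan M \<Longrightarrow> x + y \<in> nspan M"
  by (induction rule: nspan.induct) (auto intro: nspan.intros simp: add.assoc)

lemma nspan_mult_base:
  assumes "\<And>n. n \<in> N \<Longrightarrow> m * n \<in> L" "y \<in> nspan N"
  shows "m * y \<in> nspan L"
  using assms(2,1) by (induction rule: nspan.induct) (auto intro: nspan.intros simp: distrib_left)

lemma nspan_mult:
  assumes "\<And>m n. m \<in> M \<Longrightarrow> n \<in> N \<Longrightarrow> m * n \<in> L" "x \<in> nspan M" "y \<in> nspan N"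
  shows "x * y \<in> nspan L"
  using assms(2)
proof (induction rule: nspan.induct)
  case (add m x)
  then have "m * y \<in> nspan L" using assms by (intro nspan_mult_base[of N]) auto
  then show ?case using add.IH nspan_add by (auto simp: distrib_right)
qed (simp add: nspan.zero)

text \<open>The multiplicity of each generator matters only modulo the characteristic.\<close>

lemma finite_nspan:
  fixes M :: "'b::comm_semiring_1 set"
  assumes "finite M" and p: "CHAR('b) > 0"
  shows "finite (nspan M)"
proof -
  let ?p = "CHAR('b)"
  let ?f = "\<lambda>k. \<Sum>m\<in>M. of_nat (k m) * m"
  have "\<exists>k. y = ?f k" if "y \<in> nspan M" for y
    using that
  proof (induction rule: nspan.induct)
    case zero
    then show ?case by (intro exI[of _ "\<lambda>_. 0"]) simp
  next
    case (add m y)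
    then obtain k where k: "y = ?f k" by blast
    have "?f (k(m := Suc (k m))) = m + ?f k"
      using add.hyps assms(1) by (simp add: sum.remove[of M m] algebra_simps)
    then show ?case using k by metis
  qed
  moreover have "?f k = ?f (restrict (\<lambda>m. k m mod ?p) M)" for k
  proof (rule sum.cong)
    fix m assume "m \<in> M"
    have "of_nat (k m) = (of_nat (k m mod ?p + ?p * (k m div ?p)) :: 'b)"
      by (subst mod_mult_div_eq) simp
    also have "\<dots> = of_nat (k m mod ?p)" by (simp only: of_nat_add of_nat_mult of_nat_CHAR) simp
    finally show "of_nat (k m) * m = of_nat (restrict (\<lambda>m. k m mod ?p) M m) * m"
      using \<open>m \<in> M\<close> by simp
  qed simp
  moreover have "restrict (\<lambda>m. k m mod ?p) M \<in> M \<rightarrow>\<^sub>E {..<?p}" for k using p by simp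
  ultimately have "nspan M \<subseteq> ?f ` (M \<rightarrow>\<^sub>E {..<?p})" by blast
  then show ?thesis
    by (rule finite_subset) (auto intro!: finite_imageI finite_PiE assms)
qed

locale finitely_generated =
  fixes G :: "'b::field set" and p :: nat
  assumes finite_G: "finite G" and p_char: "p = CHAR('b)" and p_pos: "p > 0"
begin

lemma prime_p: "prime p"
  using p_char p_pos prime_CHAR_semidom by blast

lemma frobenius_add: "(x + y :: 'b) ^ p = x ^ p + y ^ p"
  using freshmans_dream prime_p p_char by metis

lemma frobenius_sum: "(\<Sum>i\<in>I. f i :: 'b) ^ p = (\<Sum>i\<in>I. f i ^ p)"
  using freshmans_dream_sum prime_p p_char by metis

section \<open>Degree filtration of a finitely generated ring\<close>

definition monomial :: "('b \<Rightarrow> nat) \<Rightarrow> 'b" where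
  "monomial f = (\<Prod>x\<in>G. x ^ f x)"

definition Mons :: "nat \<Rightarrow> 'b set" where
  "Mons B = monomial ` {f. sum f G \<le> B}"

text \<open>The values at \<open>G\<close> of the polynomials of total degree at most
  \<open>B\<close> over the prime field. Finiteness of these sets makes the automaton
  finite.\<close>

definition V :: "nat \<Rightarrow> 'b set" where
  "V B = nspan (Mons B)"

text \<open>These monomials generate \<open>R\<close> as a module over its \<open>p\<close>-th
  powers.\<close>

definition Box :: "'b set" where
  "Box = monomial ` {f. \<forall>x\<in>G. f x < p}"

definition R :: "'b set" where
  "R = (\<Union>B. V B)"

lemma monomial_restrict: "monomial (restrict f G) = monomial f"
  by (simp add: monomial_def)

lemma monomial_mult: "monomial f * monomial g = monomial (\<lambda>x. f x + g x)"
  by (simp add: monomial_def power_add prod.distrib)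

lemma finite_Mons: "finite (Mons B)"
proof -
  have "Mons B \<subseteq> monomial ` (G \<rightarrow>\<^sub>E {..B})"
  proof
    fix y assume "y \<in> Mons B"
    then obtain f where f: "y = monomial f" "sum f G \<le> B" by (auto simp: Mons_def)
    have "f x \<le> B" if "x \<in> G" for x
      using f member_le_sum[of x G f] that finite_G by auto
    then have "restrict f G \<in> G \<rightarrow>\<^sub>E {..B}" by auto
    then show "y \<in> monomial ` (G \<rightarrow>\<^sub>E {..B})" using f monomial_restrict by (metis imageI)
  qed
  then show ?thesis
    by (rule finite_subset) (auto intro!: finite_imageI finite_PiE finite_G)
qed

lemma finite_V: "finite (V B)"
  unfolding V_def using p_char p_pos by (intro finite_nspan finite_Mons) simp

lemma finite_Box: "finite Box"
proof -
  have "Box \<subseteq> monomial ` (G \<rightarrow>\<^sub>E {..<p})"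
  proof
    fix y assume "y \<in> Box"
    then obtain f where f: "y = monomial f" "\<forall>x\<in>G. f x < p" by (auto simp: Box_def)
    then have "restrict f G \<in> G \<rightarrow>\<^sub>E {..<p}" by auto
    then show "y \<in> monomial ` (G \<rightarrow>\<^sub>E {..<p})" using f monomial_restrict by (metis imageI)
  qed
  then show ?thesis
    by (rule finite_subset) (auto intro!: finite_imageI finite_PiE finite_G)
qed

lemma V_mono: "B \<le> B' \<Longrightarrow> y \<in> V B \<Longrightarrow> y \<in> V B'"
  unfolding V_def by (rule nspan_mono[of "Mons B"]) (auto simp: Mons_def)

lemma V_zero: "0 \<in> V B"
  by (simp add: V_def nspan.zero)

lemma V_add: "x \<in> V B \<Longrightarrow> y \<in> V B \<Longrightarrow> x + y \<in> V B"
  unfolding V_def by (rule nspan_add)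

lemma V_sum: "(\<And>i. i \<in> I \<Longrightarrow> f i \<in> V B) \<Longrightarrow> (\<Sum>i\<in>I. f i) \<in> V B"
  by (induction I rule: infinite_finite_induct) (auto simp: V_zero intro: V_add)

lemma V_mult: "x \<in> V A \<Longrightarrow> y \<in> V B \<Longrightarrow> x * y \<in> V (A + B)"
  unfolding V_def
proof (rule nspan_mult[of "Mons A" "Mons B"])
  fix m n assume "m \<in> Mons A" "n \<in> Mons B"
  then obtain f g where "m = monomial f" "n = monomial g" "sum f G \<le> A" "sum g G \<le> B"
    by (auto simp: Mons_def)
  then show "m * n \<in> Mons (A + B)"
    unfolding Mons_def by (intro image_eqI[of _ _ "\<lambda>x. f x + g x"]) (auto simp: monomial_mult sum.distrib)
qed

lemma V_one: "1 \<in> V B"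
  unfolding V_def Mons_def by (intro nspan_base image_eqI[of _ _ "\<lambda>_. 0"]) (auto simp: monomial_def)

lemma V_gen: "x \<in> G \<Longrightarrow> x \<in> V 1"
  unfolding V_def Mons_def
  by (intro nspan_base image_eqI[of _ _ "\<lambda>y. if y = x then 1 else 0"])
    (auto simp: monomial_def finite_G if_distrib[of "power _"] prod.delta cong: if_cong)

lemma V_gen_power: "x \<in> G \<Longrightarrow> x ^ j \<in> V j"
proof (induction j)
  case (Suc j)
  then show ?case using V_mult[of x 1 "x ^ j" j] V_gen by simp
qed (simp add: V_one)

lemma R_I: "x \<in> V B \<Longrightarrow> x \<in> R"
  by (auto simp: R_def)

lemma R_add: "x \<in> R \<Longrightarrow> y \<in> R \<Longrightarrow> x + y \<in> R"
proof -
  assume "x \<in> R" "y \<in> R"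
  then obtain A B where "x \<in> V A" "y \<in> V B" by (auto simp: R_def)
  then have "x \<in> V (max A B)" "y \<in> V (max A B)" using V_mono by (meson max.cobounded1 max.cobounded2)+
  then show ?thesis using V_add R_I by blast
qed

lemma R_mult: "x \<in> R \<Longrightarrow> y \<in> R \<Longrightarrow> x * y \<in> R"
  unfolding R_def using V_mult by blast

lemma R_sum: "(\<And>i. i \<in> I \<Longrightarrow> f i \<in> R) \<Longrightarrow> (\<Sum>i\<in>I. f i) \<in> R"
  by (induction I rule: infinite_finite_induct) (auto intro: R_add R_I V_zero)

lemma R_power: "x \<in> R \<Longrightarrow> x ^ n \<in> R"
  by (induction n) (auto intro: R_mult R_I V_one)

lemma of_nat_R: "of_nat n \<in> R"
  by (induction n) (auto intro: R_add R_I V_one V_zero)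

text \<open>The spans are closed under addition only, but -1 equals the natural number
  \<open>p - 1\<close> in the field.\<close>

lemma R_uminus: "x \<in> R \<Longrightarrow> - x \<in> R"
proof -
  assume "x \<in> R"
  have "of_nat (p - 1) + 1 = (of_nat p :: 'b)" using p_pos by (cases p) (auto simp: add.commute)
  also have "\<dots> = 0" using p_char by simp
  finally have "of_nat (p - 1) = (- 1 :: 'b)" by (simp add: eq_neg_iff_add_eq_0)
  then show ?thesis using R_mult[OF of_nat_R \<open>x \<in> R\<close>, of "p - 1"] by simp
qed

lemma finite_subset_R: "finite F \<Longrightarrow> F \<subseteq> R \<Longrightarrow> \<exists>A. F \<subseteq> V A"
proof (induction F rule: finite_induct)
  case (insert x F)
  then obtain A B where "F \<subseteq> V A" "x \<in> V B" by (auto simp: R_def)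
  then have "insert x F \<subseteq> V (max A B)" using V_mono by (auto intro: V_mono[of A] V_mono[of B])
  then show ?case ..
qed auto

text \<open>Division with remainder by \<open>p\<close> in each exponent writes a monomial as a
  \<open>p\<close>-th power times an element of \<open>Box\<close>, and divides the degree bound by
  \<open>p\<close>.\<close>

lemma frobenius_decomposition:
  assumes "y \<in> V B"
  shows "\<exists>l. (\<forall>m\<in>Box. l m \<in> V (B div p)) \<and> y = (\<Sum>m\<in>Box. l m ^ p * m)"
  using assms unfolding V_def[of B]
proof (induction rule: nspan.induct)
  case zero
  then show ?case using p_pos by (intro exI[of _ "\<lambda>_. 0"]) (simp add: V_zero power_0_left)
next
  case (add u y)
  then obtain l where l: "\<forall>m\<in>Box. l m \<in> V (B div p)" "y = (\<Sum>m\<in>Box. l m ^ p * m)" by blast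
  obtain f where f: "u = monomial f" "sum f G \<le> B" using add.hyps by (auto simp: Mons_def)
  define m0 where "m0 = monomial (\<lambda>x. f x mod p)"
  define n0 where "n0 = monomial (\<lambda>x. f x div p)"
  have m0: "m0 \<in> Box" unfolding m0_def Box_def using p_pos by auto
  have "p * (\<Sum>x\<in>G. f x div p) \<le> sum f G"
    unfolding sum_distrib_left by (intro sum_mono) simp
  then have "(\<Sum>x\<in>G. f x div p) \<le> B div p"
    using f p_pos by (simp add: less_eq_div_iff_mult_less_eq mult.commute)
  then have n0: "n0 \<in> V (B div p)" unfolding n0_def V_def Mons_def by (intro nspan_base) auto
  have "n0 ^ p * m0 = u"
    unfolding n0_def m0_def f monomial_def
    by (simp add: prod_power_distrib flip: prod.distrib power_mult power_add)
  moreover have "(\<Sum>m\<in>Box. (l(m0 := n0 + l m0)) m ^ p * m) = n0 ^ p * m0 + y"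
    unfolding l(2) using m0 finite_Box
    by (simp add: sum.remove[of Box m0] frobenius_add algebra_simps)
  ultimately show ?case
    using l(1) n0 by (intro exI[of _ "l(m0 := n0 + l m0)"]) (auto intro: V_add)
qed

text \<open>Linear independence over the ring of \<open>p\<close>-th powers of
  \<open>R\<close>.\<close>

definition indep :: "'b set \<Rightarrow> bool" where
  "indep M \<longleftrightarrow> (\<forall>r. (\<forall>m\<in>M. r m \<in> R) \<and> (\<Sum>m\<in>M. r m ^ p * m) = 0 \<longrightarrow> (\<forall>m\<in>M. r m = 0))"

lemma indepD:
  assumes "indep M" "\<And>m. m \<in> M \<Longrightarrow> r m \<in> R" "(\<Sum>m\<in>M. r m ^ p * m) = 0" "m \<in> M"
  shows "r m = 0"
  using assms unfolding indep_def by blast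

text \<open>\<open>M\<close> is a maximal independent subset of \<open>Box\<close>. Adding a further
  \<open>m\<close> produces a relation in which \<open>m\<close> has a nonzero coefficient, and this
  coefficient serves as the denominator \<open>g\<close>.\<close>

lemma indep_basis:
  obtains M where "M \<subseteq> Box" "indep M"
    "\<And>m. m \<in> Box \<Longrightarrow> \<exists>g\<in>R. g \<noteq> 0 \<and> (\<exists>r. (\<forall>b\<in>M. r b \<in> R) \<and> g ^ p * m = (\<Sum>b\<in>M. r b ^ p * b))"
proof -
  let ?F = "{M. M \<subseteq> Box \<and> indep M}"
  have "finite ?F" using finite_Box by simp
  moreover have "{} \<in> ?F" by (simp add: indep_def)
  ultimately obtain M where M: "M \<in> ?F" "\<forall>N\<in>?F. M \<subseteq> N \<longrightarrow> M = N"
    using finite_has_maximal[of ?F] by auto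
  have finM: "finite M" using M finite_Box finite_subset by blast
  have "\<exists>g\<in>R. g \<noteq> 0 \<and> (\<exists>r. (\<forall>b\<in>M. r b \<in> R) \<and> g ^ p * m = (\<Sum>b\<in>M. r b ^ p * b))" if m: "m \<in> Box" for m
  proof (cases "m \<in> M")
    case True
    show ?thesis
    proof (intro bexI conjI exI ballI)
      let ?r = "\<lambda>b. if b = m then 1 else 0 :: 'b"
      show "1 ^ p * m = (\<Sum>b\<in>M. ?r b ^ p * b)"
        using True finM p_pos by (simp add: sum.remove[of M m] power_0_left)
    qed (auto intro: R_I[OF V_one] R_I[OF V_zero])
  next
    case False
    then have "\<not> indep (insert m M)" using M m by blast
    then obtain r where r: "\<forall>b\<in>insert m M. r b \<in> R" "(\<Sum>b\<in>insert m M. r b ^ p * b) = 0"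
      "\<not> (\<forall>b\<in>insert m M. r b = 0)" by (auto simp: indep_def)
    have eq: "r m ^ p * m + (\<Sum>b\<in>M. r b ^ p * b) = 0" using r(2) False finM by simp
    have "r m \<noteq> 0"
    proof
      assume "r m = 0"
      then have "(\<Sum>b\<in>M. r b ^ p * b) = 0" using eq p_pos by (simp add: power_0_left)
      then have "\<forall>b\<in>M. r b = 0" using M(1) r(1) unfolding indep_def by blast
      then show False using r(3) \<open>r m = 0\<close> by simp
    qed
    moreover have neg: "(\<Sum>b\<in>M. (- r b) ^ p * b) = - (\<Sum>b\<in>M. r b ^ p * b)"
      by (simp only: minus_power_prime_CHAR[OF p_char prime_p] sum_negf mult_minus_left)
    moreover have "r m ^ p * m = (\<Sum>b\<in>M. (- r b) ^ p * b)"
      unfolding neg using eq by (rule eq_neg_iff_add_eq_0[THEN iffD2])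
    ultimately show ?thesis using r(1) R_uminus
      by (intro bexI[of _ "r m"] conjI exI[of _ "\<lambda>b. - r b"]) auto
  qed
  then show ?thesis using M that by blast
qed

lemma common_denominator:
  assumes "finite A"
    and "\<And>m. m \<in> A \<Longrightarrow> \<exists>g\<in>R. g \<noteq> 0 \<and> (\<exists>r. (\<forall>b\<in>M. r b \<in> R) \<and> g ^ p * m = (\<Sum>b\<in>M. r b ^ p * b))"
  shows "\<exists>g\<in>R. g \<noteq> 0 \<and> (\<forall>m\<in>A. \<exists>r. (\<forall>b\<in>M. r b \<in> R) \<and> g ^ p * m = (\<Sum>b\<in>M. r b ^ p * b))"
  using assms
proof (induction A rule: finite_induct)
  case empty
  then show ?case by (intro bexI[of _ 1]) (auto intro: R_I[OF V_one])
next
  case (insert m A)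
  obtain g where g: "g \<in> R" "g \<noteq> 0" "\<exists>r. (\<forall>b\<in>M. r b \<in> R) \<and> g ^ p * m = (\<Sum>b\<in>M. r b ^ p * b)"
    using insert.prems[of m] by blast
  obtain h where h: "h \<in> R" "h \<noteq> 0"
    "\<forall>m\<in>A. \<exists>r. (\<forall>b\<in>M. r b \<in> R) \<and> h ^ p * m = (\<Sum>b\<in>M. r b ^ p * b)"
    using insert by blast
  have scale: "\<exists>r. (\<forall>b\<in>M. r b \<in> R) \<and> (x * y) ^ p * m = (\<Sum>b\<in>M. r b ^ p * b)"
    if y: "\<exists>r. (\<forall>b\<in>M. r b \<in> R) \<and> y ^ p * m = (\<Sum>b\<in>M. r b ^ p * b)" and x: "x \<in> R" for x y m
  proof -
    obtain r where r: "\<forall>b\<in>M. r b \<in> R" "y ^ p * m = (\<Sum>b\<in>M. r b ^ p * b)" using y by blast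
    have "(x * y) ^ p * m = x ^ p * (y ^ p * m)" by (simp add: power_mult_distrib mult_ac)
    also have "\<dots> = (\<Sum>b\<in>M. (x * r b) ^ p * b)"
      unfolding r(2) by (simp add: sum_distrib_left power_mult_distrib mult_ac)
    finally show ?thesis using r(1) x by (intro exI[of _ "\<lambda>b. x * r b"]) (auto intro: R_mult)
  qed
  have "\<forall>m'\<in>insert m A. \<exists>r. (\<forall>b\<in>M. r b \<in> R) \<and> (h * g) ^ p * m' = (\<Sum>b\<in>M. r b ^ p * b)"
  proof
    fix m' assume "m' \<in> insert m A"
    then consider "m' = m" | "m' \<in> A" by blast
    then show "\<exists>r. (\<forall>b\<in>M. r b \<in> R) \<and> (h * g) ^ p * m' = (\<Sum>b\<in>M. r b ^ p * b)"
    proof cases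
      case 1
      then show ?thesis using scale[OF g(3) h(1)] by simp
    next
      case 2
      then show ?thesis using scale[OF bspec[OF h(3) 2] g(1)] by (simp only: mult.commute)
    qed
  qed
  then show ?case using g h by (intro bexI[of _ "h * g"]) (auto intro: R_mult)
qed

text \<open>Dividing by \<open>p\<close> beats the fixed increase of degree caused by the common denominator, so a
  single degree bound is preserved.\<close>

lemma bounded_decomposition:
  obtains B M g where "B \<ge> 1" "indep M" "finite M" "g \<noteq> 0"
    "\<And>x y j. x \<in> V B \<Longrightarrow> y \<in> G \<Longrightarrow> j < p \<Longrightarrow>
       \<exists>l. (\<forall>b\<in>M. l b \<in> V B) \<and> g ^ p * (x * y ^ j) = (\<Sum>b\<in>M. l b ^ p * b)"
proof -
  obtain M where M: "M \<subseteq> Box" "indep M"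
    "\<And>m. m \<in> Box \<Longrightarrow> \<exists>g\<in>R. g \<noteq> 0 \<and> (\<exists>r. (\<forall>b\<in>M. r b \<in> R) \<and> g ^ p * m = (\<Sum>b\<in>M. r b ^ p * b))"
    using indep_basis by blast
  have finM: "finite M" using M finite_Box finite_subset by blast
  obtain g where g: "g \<noteq> 0"
    "\<forall>m\<in>Box. \<exists>r. (\<forall>b\<in>M. r b \<in> R) \<and> g ^ p * m = (\<Sum>b\<in>M. r b ^ p * b)"
    using common_denominator[OF finite_Box M(3)] by blast
  then obtain r where r: "\<And>m b. m \<in> Box \<Longrightarrow> b \<in> M \<Longrightarrow> r m b \<in> R"
    "\<And>m. m \<in> Box \<Longrightarrow> g ^ p * m = (\<Sum>b\<in>M. r m b ^ p * b)" by metis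
  have "(\<lambda>(m, b). r m b) ` (Box \<times> M) \<subseteq> R" using r(1) by auto
  then obtain A where "(\<lambda>(m, b). r m b) ` (Box \<times> M) \<subseteq> V A"
    using finite_subset_R finite_Box finM by (metis finite_SigmaI finite_imageI)
  then have A: "r m b \<in> V A" if "m \<in> Box" "b \<in> M" for m b using that by auto
  \<comment> \<open>This makes \<open>A + (B + (p - 1)) div p \<le> B\<close>: the quotient is
    \<open>2 * A div p + 1\<close>, at most \<open>A + 1\<close> because
    \<open>p \<ge> 2\<close>.\<close>
  define B where "B = 2 * A + 1"
  have "\<exists>l. (\<forall>b\<in>M. l b \<in> V B) \<and> g ^ p * (x * y ^ j) = (\<Sum>b\<in>M. l b ^ p * b)"
    if "x \<in> V B" "y \<in> G" "j < p" for x y j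
  proof -
    have "x * y ^ j \<in> V (B + j)" using that V_mult V_gen_power by blast
    then have "x * y ^ j \<in> V (B + (p - 1))" using that V_mono[of "B + j" "B + (p - 1)"] by simp
    then obtain l where l: "\<forall>m\<in>Box. l m \<in> V ((B + (p - 1)) div p)"
      "x * y ^ j = (\<Sum>m\<in>Box. l m ^ p * m)" using frobenius_decomposition by blast
    have "B + (p - 1) = 2 * A + p" using p_pos by (simp add: B_def)
    then have "(B + (p - 1)) div p = 2 * A div p + 1" using p_pos by simp
    also have "2 * A div p \<le> 2 * A div 2"
      using prime_ge_2_nat[OF prime_p] by (intro div_le_mono2) auto
    finally have deg: "A + (B + (p - 1)) div p \<le> B" by (simp add: B_def)
    define l' where "l' b = (\<Sum>m\<in>Box. r m b * l m)" for b
    have l': "l' b \<in> V B" if "b \<in> M" for b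
      unfolding l'_def using A l(1) that V_mono[OF deg] V_mult by (intro V_sum) blast
    have "g ^ p * (x * y ^ j) = (\<Sum>m\<in>Box. l m ^ p * (g ^ p * m))"
      unfolding l(2) by (simp add: sum_distrib_left mult_ac)
    also have "\<dots> = (\<Sum>m\<in>Box. \<Sum>b\<in>M. (r m b * l m) ^ p * b)"
      using r(2) by (simp add: sum_distrib_left power_mult_distrib mult_ac)
    also have "\<dots> = (\<Sum>b\<in>M. l' b ^ p * b)"
      unfolding l'_def frobenius_sum sum_distrib_right by (rule sum.swap)
    finally show ?thesis using l' by blast
  qed
  moreover have "B \<ge> 1" by (simp add: B_def)
  ultimately show ?thesis using that M(2) finM g(1) by blast
qed

end

context frobenius_diagonal
begin

section \<open>Linear relations among the points as states\<close>

definition annihilator :: "(nat \<Rightarrow> 'b) set \<Rightarrow> (nat \<Rightarrow> 'b) set" where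
  "annihilator W = {v. (\<forall>i\<ge>d. v i = 0) \<and> (\<forall>w\<in>W. (\<Sum>i<d. w i * v i) = 0)}"

lemma subsp_annihilator: "subsp (annihilator W)"
proof -
  have "(\<Sum>i<d. w i * (k * v i)) = k * (\<Sum>i<d. w i * v i)" for w v :: "nat \<Rightarrow> 'b" and k
    by (simp add: sum_distrib_left mult_ac)
  then show ?thesis
    by (auto simp: subsp_def annihilator_def distrib_left sum.distrib)
qed

lemma sum_pt: "(\<Sum>i<d. w i * pt (int n) i) = (\<Sum>i<d. w i * \<alpha> i ^ n)"
  by (intro sum.cong) (auto simp: pt_def)

lemma sum_restrict: "(\<Sum>i<d. restrict w {..<d} i * v i) = (\<Sum>i<d. w i * v i)"
  by (intro sum.cong) auto

lemma pt_annihilator_iff: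
  "pt (int n) \<in> annihilator W \<longleftrightarrow> (\<forall>w\<in>W. (\<Sum>i<d. w i * \<alpha> i ^ n) = 0)"
  by (simp add: annihilator_def sum_pt) (simp add: pt_def)

text \<open>States are solution spaces of sets of relations with coefficients in the finite set
  \<open>fg.V B\<close>. A relation for \<open>p * n + j\<close>, multiplied by \<open>g ^ p\<close>
  and expanded over \<open>M\<close>, is a combination of \<open>M\<close> whose coefficients are
  \<open>p\<close>-th powers of relations for \<open>n\<close>. Independence of \<open>M\<close>
  makes these vanish one by one, and their coefficients are again in \<open>fg.V B\<close>.\<close>

lemma exists_automaton:
  fixes c :: "nat \<Rightarrow> 'b"
  shows "\<exists>S T. annihilator {c} \<in> S \<and> frobenius_automaton \<alpha> d p S T"
proof -
  interpret fg: finitely_generated "\<alpha> ` {..<d} \<union> c ` {..<d}" p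
    by (rule finitely_generated.intro) (use p_char p_pos in simp_all)
  obtain B M g where B: "B \<ge> 1" and M: "fg.indep M" "finite M" and g: "g \<noteq> 0"
    and dec: "\<And>x y j. x \<in> fg.V B \<Longrightarrow> y \<in> \<alpha> ` {..<d} \<union> c ` {..<d} \<Longrightarrow> j < p \<Longrightarrow>
       \<exists>l. (\<forall>b\<in>M. l b \<in> fg.V B) \<and> g ^ p * (x * y ^ j) = (\<Sum>b\<in>M. l b ^ p * b)"
    using fg.bounded_decomposition by blast
  \<comment> \<open>Extensional functions, so that finitely many coefficients give finitely many
    relations.\<close>
  define rel where "rel = {..<d} \<rightarrow>\<^sub>E fg.V B"
  define Q where "Q w j l \<longleftrightarrow>
      (\<forall>i<d. (\<forall>b\<in>M. l i b \<in> fg.V B) \<and> g ^ p * (w i * \<alpha> i ^ j) = (\<Sum>b\<in>M. l i b ^ p * b))" for w j l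
  have Q_ex: "\<exists>l. Q w j l" if "w \<in> rel" "j < p" for w j
  proof -
    have "\<exists>l. (\<forall>b\<in>M. l b \<in> fg.V B) \<and> g ^ p * (w i * \<alpha> i ^ j) = (\<Sum>b\<in>M. l b ^ p * b)" if "i < d" for i
      using that \<open>w \<in> rel\<close> \<open>j < p\<close> by (intro dec) (auto simp: rel_def)
    then have "\<forall>i\<in>{..<d}. \<exists>l. (\<forall>b\<in>M. l b \<in> fg.V B) \<and> g ^ p * (w i * \<alpha> i ^ j) = (\<Sum>b\<in>M. l b ^ p * b)"
      by blast
    from bchoice[OF this] show ?thesis by (auto simp: Q_def)
  qed
  define l where "l w j = (SOME l. Q w j l)" for w j
  have "Q w j (l w j)" if "w \<in> rel" "j < p" for w j
    unfolding l_def using Q_ex[OF that] by (rule someI_ex)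
  then have l: "\<And>w j i b. w \<in> rel \<Longrightarrow> j < p \<Longrightarrow> i < d \<Longrightarrow> b \<in> M \<Longrightarrow> l w j i b \<in> fg.V B"
    "\<And>w j i. w \<in> rel \<Longrightarrow> j < p \<Longrightarrow> i < d \<Longrightarrow> g ^ p * (w i * \<alpha> i ^ j) = (\<Sum>b\<in>M. l w j i b ^ p * b)"
    by (auto simp: Q_def)
  have key: "g ^ p * (\<Sum>i<d. w i * (\<alpha> i ^ j * v i ^ p)) = (\<Sum>b\<in>M. (\<Sum>i<d. l w j i b * v i) ^ p * b)"
    if "w \<in> rel" "j < p" for w j v
  proof -
    have "g ^ p * (\<Sum>i<d. w i * (\<alpha> i ^ j * v i ^ p)) = (\<Sum>i<d. g ^ p * (w i * \<alpha> i ^ j) * v i ^ p)"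
      by (simp add: sum_distrib_left mult_ac)
    also have "\<dots> = (\<Sum>i<d. \<Sum>b\<in>M. (l w j i b * v i) ^ p * b)"
    proof (intro sum.cong refl)
      fix i assume "i \<in> {..<d}"
      then have eq: "g ^ p * (w i * \<alpha> i ^ j) = (\<Sum>b\<in>M. l w j i b ^ p * b)" using l(2) that by simp
      show "g ^ p * (w i * \<alpha> i ^ j) * v i ^ p = (\<Sum>b\<in>M. (l w j i b * v i) ^ p * b)"
        unfolding eq sum_distrib_right by (simp add: power_mult_distrib mult_ac)
    qed
    also have "\<dots> = (\<Sum>b\<in>M. (\<Sum>i<d. l w j i b * v i) ^ p * b)"
      unfolding fg.frobenius_sum sum_distrib_right by (rule sum.swap)
    finally show ?thesis .
  qed
  define next_rel where "next_rel W j = (\<Union>w\<in>W. (\<lambda>b. restrict (\<lambda>i. l w j i b) {..<d}) ` M)" for W j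
  have next_rel: "v \<in> annihilator (next_rel W j) \<longleftrightarrow>
      (\<forall>i\<ge>d. v i = 0) \<and> (\<forall>w\<in>W. \<forall>b\<in>M. (\<Sum>i<d. l w j i b * v i) = 0)" for v W j
    unfolding annihilator_def next_rel_def by (simp add: sum_restrict del: restrict_apply)
  have next_in: "next_rel W j \<subseteq> rel" if "W \<subseteq> rel" "j < p" for W j
    using l(1) that unfolding next_rel_def rel_def by (auto simp: subset_iff split: if_splits)
  define S where "S = annihilator ` Pow rel"
  define P where "P U j U' \<longleftrightarrow> U' \<in> S \<and> act (int j) 1 ` U' \<subseteq> U \<and>
      (\<forall>n. pt (int (p * n + j)) \<in> U \<longrightarrow> pt (int n) \<in> U')" for U j U'
  have P_ex: "\<exists>U'. P U j U'" if "U \<in> S" "j < p" for U j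
  proof -
    obtain W where W: "W \<subseteq> rel" "U = annihilator W" using \<open>U \<in> S\<close> by (auto simp: S_def)
    let ?U = "annihilator (next_rel W j)"
    have "?U \<in> S" using next_in[OF W(1) that(2)] by (simp add: S_def)
    moreover have "act (int j) 1 v \<in> U" if v: "v \<in> ?U" for v
    proof -
      have "(\<Sum>i<d. w i * act (int j) 1 v i) = 0" if w: "w \<in> W" for w
      proof -
        have "g ^ p * (\<Sum>i<d. w i * (\<alpha> i ^ j * v i ^ p)) = 0"
          using key[of w j v] w v W(1) \<open>j < p\<close> p_pos unfolding next_rel
          by (auto simp: power_0_left)
        then show ?thesis using g by (simp add: act_def)
      qed
      then show ?thesis using v unfolding W(2) by (auto simp: annihilator_def)
    qed
    moreover have "pt (int n) \<in> ?U" if n: "pt (int (p * n + j)) \<in> U" for n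
    proof -
      have "\<forall>b\<in>M. (\<Sum>i<d. l w j i b * \<alpha> i ^ n) = 0" if w: "w \<in> W" for w
      proof -
        have "(\<Sum>i<d. w i * (\<alpha> i ^ j * (\<alpha> i ^ n) ^ p)) = (\<Sum>i<d. w i * \<alpha> i ^ (p * n + j))"
          by (simp add: power_add mult_ac flip: power_mult)
        also have "\<dots> = 0" using n w unfolding W(2) pt_annihilator_iff by blast
        finally have "(\<Sum>b\<in>M. (\<Sum>i<d. l w j i b * \<alpha> i ^ n) ^ p * b) = 0"
          using key[of w j "\<lambda>i. \<alpha> i ^ n"] w W(1) \<open>j < p\<close> by auto
        \<comment> \<open>Independence of \<open>M\<close> speaks only of coefficients in
          \<open>fg.R\<close>. Powers of \<open>\<alpha> i\<close> lie there, whereas the entries of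
          a general vector of \<open>U\<close> may not; hence \<open>pt_T\<close> is a statement
          about points.\<close>
        moreover have "(\<Sum>i<d. l w j i b * \<alpha> i ^ n) \<in> fg.R" if "b \<in> M" for b
          using that l(1) w W(1) \<open>j < p\<close>
          by (intro fg.R_sum fg.R_mult fg.R_power) (auto intro: fg.R_I[OF l(1)] fg.R_I[OF fg.V_gen])
        ultimately show ?thesis
          using fg.indepD[OF M(1), where r = "\<lambda>b. \<Sum>i<d. l w j i b * \<alpha> i ^ n"] by blast
      qed
      then have "\<forall>w\<in>W. \<forall>b\<in>M. (\<Sum>i<d. l w j i b * pt (int n) i) = 0"
        by (simp add: sum_pt)
      then show ?thesis unfolding next_rel by (simp add: pt_def)
    qed
    ultimately show ?thesis unfolding P_def by blast
  qed
  define T where "T U j = (SOME U'. P U j U')" for U j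
  have T: "P U j (T U j)" if "U \<in> S" "j < p" for U j
    unfolding T_def using P_ex[OF that] by (rule someI_ex)
  have "finite S" unfolding S_def rel_def
    by (intro finite_imageI) (simp add: finite_PiE fg.finite_V)
  then have "frobenius_automaton \<alpha> d p S T"
    using T by unfold_locales (auto simp: P_def S_def subsp_annihilator)
  moreover have "annihilator {c} \<in> S"
  proof -
    have "annihilator {c} = annihilator {restrict c {..<d}}"
      unfolding annihilator_def by (simp add: sum_restrict del: restrict_apply)
    moreover have "c i \<in> fg.V B" if "i < d" for i
      using fg.V_mono[OF B] fg.V_gen that by blast
    then have "restrict c {..<d} \<in> rel" by (auto simp: rel_def)
    ultimately show ?thesis by (simp add: S_def)
  qed
  ultimately show ?thesis by blast
qed

text \<open>Equal rank would make the hyperplane the whole space, but it misses the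
  \<open>i\<close>-th unit vector.\<close>

lemma rank_hyperplane:
  assumes "i < d" "c i \<noteq> 0"
  shows "rank (annihilator {c}) < d"
proof -
  let ?A = "annihilator {}"
  have "rank (annihilator {c}) \<noteq> rank ?A"
  proof
    assume "rank (annihilator {c}) = rank ?A"
    moreover have "annihilator {c} \<subseteq> ?A" by (auto simp: annihilator_def)
    ultimately have eq: "annihilator {c} = ?A"
      using subsp_rank_eq[OF subsp_annihilator subsp_annihilator] by simp
    have "(\<lambda>j. if j = i then 1 else 0) \<in> ?A" using assms by (simp add: annihilator_def)
    then show False
      unfolding eq[symmetric] using assms
      by (simp add: annihilator_def if_distrib sum.delta' cong: if_cong)
  qed
  moreover have "rank (annihilator {c}) \<le> rank ?A" by (rule rank_mono) (auto simp: annihilator_def)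
  ultimately show ?thesis using rank_le[of ?A] by linarith
qed

theorem cov_exponential_sum:
  assumes "i < d" "c i \<noteq> 0" "d \<ge> 2"
  obtains e where "e > 0" "cov (p ^ e) (annihilator {c}) {n. (\<Sum>i<d. c i * \<alpha> i ^ n) = 0} (d - 2)"
proof -
  obtain S T where S: "annihilator {c} \<in> S" "frobenius_automaton \<alpha> d p S T"
    using exists_automaton by blast
  interpret frobenius_automaton \<alpha> d p S T by fact
  have Z: "Z (annihilator {c}) = {n. (\<Sum>i<d. c i * \<alpha> i ^ n) = 0}"
    by (simp add: Z_def pt_annihilator_iff)
  have "cov (p ^ period) (annihilator {c}) (Z (annihilator {c})) (d - 2)"
    using rank_hyperplane[of i c] assms(1,2) assms(3) by (intro cov_Z S) auto
  then show ?thesis using that[OF period_pos] unfolding Z by blast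
qed

end

subsection \<open>Elementary nested sets\<close>

lemma of_int_bracket: "q > 1 \<Longrightarrow> of_int (bracket q k) = ((of_nat q ^ k - 1) / (of_nat q - 1) :: rat)"
proof -
  assume "q > 1"
  then have "(of_nat q :: rat) \<noteq> 1" by simp
  moreover have "(of_nat q - 1) * of_int (bracket q k) = (of_nat q ^ k - 1 :: rat)"
    using arg_cong[OF bracket_mult[of q k], of "of_int :: int \<Rightarrow> rat"] by simp
  ultimately show ?thesis by (simp add: field_simps)
qed

lemma UN_split_pred: "(\<Union>x\<in>D. f x) = (\<Union>x\<in>{x\<in>D. \<not> P x}. f x) \<union> (\<Union>x\<in>{x\<in>D. P x}. f x)"
  by blast

lemma bracket_nonneg: "bracket q k \<ge> 0"
  by (simp add: bracket_def sum_nonneg)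

text \<open>The piece with integer parameters \<open>a; b\<^sub>1, \<dots>, b\<^sub>r\<close> is the elementary set with
  \<open>c\<^sub>i = b\<^sub>i / (q - 1)\<close> and \<open>c\<^sub>0 + c\<^sub>1 + \<dots> + c\<^sub>r = a\<close>.\<close>

lemma elem_set_eq_pieces:
  assumes q: "q > 1"
  shows "elem_set q (of_int a - of_int (sum_list bs) / (of_nat q - 1))
      (map (\<lambda>b. of_int b / (of_nat q - 1)) bs) =
    {n. \<exists>ks. length ks = length bs \<and> int n = piece_val q a bs ks}"
proof -
  let ?q = "of_nat q :: rat"
  have q1: "?q - 1 \<noteq> 0" using q by simp
  have "of_int a - of_int (sum_list bs) / (?q - 1) +
      (\<Sum>i<length bs. map (\<lambda>b. of_int b / (?q - 1)) bs ! i * ?q ^ (ks ! i)) =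
      of_int (piece_val q a bs ks)" for ks
  proof -
    have "of_int (sum_list bs) = (\<Sum>i<length bs. of_int (bs ! i) :: rat)"
      by (simp add: sum_list_sum_nth atLeast0LessThan)
    then have "of_int a - of_int (sum_list bs) / (?q - 1) +
      (\<Sum>i<length bs. map (\<lambda>b. of_int b / (?q - 1)) bs ! i * ?q ^ (ks ! i)) =
      of_int a + (\<Sum>i<length bs. of_int (bs ! i) / (?q - 1) * ?q ^ (ks ! i) - of_int (bs ! i) / (?q - 1))"
      by (simp add: sum_subtractf sum_divide_distrib)
    also have "\<dots> = of_int a + (\<Sum>i<length bs. of_int (bs ! i) * ((?q ^ (ks ! i) - 1) / (?q - 1)))"
      by (simp add: algebra_simps diff_divide_distrib)
    also have "\<dots> = of_int (piece_val q a bs ks)"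
      by (simp add: piece_val_def of_int_bracket[OF q])
    finally show ?thesis .
  qed
  moreover have "(of_nat n = (of_int m :: rat)) \<longleftrightarrow> int n = m" for n m
    by (metis of_int_eq_iff of_int_of_nat_eq)
  ultimately show ?thesis by (simp add: elem_set_def)
qed

context frobenius_diagonal
begin

lemma p_nested_of_cov:
  assumes e: "e > 0" and cov: "cov (p ^ e) U (Z U) k"
  shows "p_nested_le p (int k) (Z U)"
proof -
  let ?q = "p ^ e"
  have q: "?q > 1" using p_ge_2 e by (intro one_less_power) auto
  obtain D where "covers ?q U (Z U) k D" using cov by (auto simp: cov_def)
  note D = coversD[OF this]
  define el where "el = (\<lambda>(a, bs). {n. \<exists>ks. length ks = length bs \<and> int n = piece_val ?q a bs ks})"
  define pos where "pos = (\<lambda>(a :: int, bs :: int list). \<exists>b\<in>set bs. b > 0)"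
  have Z: "Z U = (\<Union>x\<in>D. el x)"
  proof
    show "Z U \<subseteq> (\<Union>x\<in>D. el x)" using D(3) unfolding el_def by fast
    show "(\<Union>x\<in>D. el x) \<subseteq> Z U"
    proof
      fix n assume "n \<in> (\<Union>x\<in>D. el x)"
      then obtain a bs ks where "(a, bs) \<in> D" "length ks = length bs" "int n = piece_val ?q a bs ks"
        by (auto simp: el_def)
      then show "n \<in> Z U" using D(2)[of a bs] by (simp add: piece_ok_def Z_def)
    qed
  qed
  \<comment> \<open>Elementary sets require a positive coefficient. A piece without one is bounded
    above by \<open>a\<close>, so its natural numbers go to the finite part.\<close>
  define F where "F = (\<Union>x\<in>{x\<in>D. \<not> pos x}. el x)"
  define param where "param = (\<lambda>(a, bs). (?q, of_int a - of_int (sum_list bs) / (of_nat ?q - 1 :: rat),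
    map (\<lambda>b. of_int b / (of_nat ?q - 1 :: rat)) bs))"
  have "finite (el x)" if "\<not> pos x" for x
  proof -
    obtain a bs where x: "x = (a, bs)" by (cases x)
    have "piece_val ?q a bs ks \<le> a" for ks
    proof -
      have "bs ! i * bracket ?q (ks ! i) \<le> 0" if "i < length bs" for i
        using \<open>\<not> pos x\<close> that nth_mem[OF that] bracket_nonneg[of ?q "ks ! i"]
        unfolding x pos_def by (auto intro!: mult_nonpos_nonneg simp: not_less)
      then have "(\<Sum>i<length bs. bs ! i * bracket ?q (ks ! i)) \<le> 0" by (intro sum_nonpos) simp
      then show ?thesis by (simp add: piece_val_def)
    qed
    then have "int n \<le> a" if "n \<in> el x" for n using that by (auto simp: el_def x)
    then have "el x \<subseteq> {..nat a}" by force
    then show ?thesis by (rule finite_subset) simp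
  qed
  then have "finite F" using D(1) by (auto simp: F_def)
  moreover have "finite (param ` {x\<in>D. pos x})" using D(1) by simp
  moreover have "\<forall>(q, c0, cs)\<in>param ` {x\<in>D. pos x}. valid_elem_params p q c0 cs \<and> int (length cs) \<le> int k"
  proof -
    have "valid_elem_params p ?q (of_int a - of_int (sum_list bs) / (of_nat ?q - 1))
        (map (\<lambda>b. of_int b / (of_nat ?q - 1)) bs) \<and> length bs \<le> k"
      if abs: "(a, bs) \<in> D" "pos (a, bs)" for a bs
    proof -
      let ?r = "of_nat ?q - 1 :: rat"
      have r: "?r > 0" using q by (metis diff_gt_0_iff_gt of_nat_1 of_nat_less_iff)
      obtain b where b: "b \<in> set bs" "b > 0" using abs(2) by (auto simp: pos_def)
      have ok: "length bs \<le> k" "0 \<notin> set bs" using D(2)[OF abs(1)] by (auto simp: piece_ok_def)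
      have "?r * (of_int a - of_int (sum_list bs) / ?r) = ?r * of_int a - of_int (sum_list bs)"
        using r by (simp add: right_diff_distrib)
      also have "\<dots> \<in> \<int>" by (intro Ints_diff Ints_mult) auto
      finally have c0: "?r * (of_int a - of_int (sum_list bs) / ?r) \<in> \<int>" .
      have cs: "?r * (of_int b / ?r) \<in> \<int>" for b
        using r by simp
      have "sum_list (map (\<lambda>b. of_int b / ?r) bs) = of_int (sum_list bs) / ?r"
        by (induction bs) (auto simp: add_divide_distrib)
      then have sum: "of_int a - of_int (sum_list bs) / ?r + sum_list (map (\<lambda>b. of_int b / ?r) bs) \<in> \<int>"
        by simp
      have "bs \<noteq> []" using b by auto
      then have "length bs \<ge> 1" by (cases bs) auto
      moreover have "\<exists>e'\<ge>1. p ^ e = p ^ e'" using e by (intro exI[of _ e]) auto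
      moreover have "\<forall>c\<in>set (map (\<lambda>b. of_int b / ?r) bs). c \<noteq> 0" using ok r by auto
      moreover have "\<exists>c\<in>set (map (\<lambda>b. of_int b / ?r) bs). c > 0"
        using b r by (intro bexI[of _ "of_int b / ?r"]) auto
      ultimately show ?thesis
        unfolding valid_elem_params_def using c0 cs sum ok(1) by simp
    qed
    then show ?thesis by (auto simp: param_def)
  qed
  moreover have "Z U = F \<union> (\<Union>(q, c0, cs)\<in>param ` {x\<in>D. pos x}. elem_set q c0 cs)"
  proof -
    have "(case param x of (q, c0, cs) \<Rightarrow> elem_set q c0 cs) = el x" for x
      unfolding param_def el_def using elem_set_eq_pieces[OF q] by (auto split: prod.splits)
    then have "(\<Union>(q, c0, cs)\<in>param ` {x\<in>D. pos x}. elem_set q c0 cs) = (\<Union>x\<in>{x\<in>D. pos x}. el x)"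
      by simp
    then show ?thesis unfolding Z F_def by (simp only: UN_split_pred[of el D pos])
  qed
  ultimately show ?thesis unfolding p_nested_le_def by (intro exI conjI)
qed

end

subsection \<open>Recurrence sequences as exponential sums\<close>

lemma shift_apply_0: "shift_apply 0 a = (\<lambda>_. 0)"
  by (simp add: shift_apply_def)

lemma shift_apply_pCons:
  "shift_apply (pCons c P) a = (\<lambda>n. c * a n + shift_apply P a (Suc n))"
proof (cases "P = 0")
  case False
  show ?thesis
    unfolding shift_apply_def degree_pCons_eq[OF False] sum.atMost_Suc_shift by simp
qed (simp add: shift_apply_def)

lemma shift_apply_add: "shift_apply (P + Q) a = (\<lambda>n. shift_apply P a n + shift_apply Q a n)"
  by (induction P Q rule: poly_induct2)
    (simp_all add: shift_apply_0 shift_apply_pCons algebra_simps)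

lemma shift_apply_smult: "shift_apply (smult c P) a = (\<lambda>n. c * shift_apply P a n)"
  by (induction P) (simp_all add: shift_apply_0 shift_apply_pCons algebra_simps)

lemma shift_apply_mult: "shift_apply (P * Q) a = shift_apply P (shift_apply Q a)"
  by (induction P)
    (simp_all add: shift_apply_0 shift_apply_pCons shift_apply_add shift_apply_smult)

lemma shift_apply_zero_seq: "shift_apply P (\<lambda>_. 0) = (\<lambda>_. 0)"
  by (simp add: shift_apply_def)

text \<open>An annihilating polynomial of least degree divides all others, by division with
  remainder. Its monic multiple is the unique witness for the description operator.\<close>

lemma min_poly_seq_props:
  assumes "is_recurrence a"
  shows "lead_coeff (min_poly_seq a) = 1" "shift_apply (min_poly_seq a) a = (\<lambda>_. 0)"
proof -
  let ?I = "\<lambda>P. shift_apply P a = (\<lambda>_. 0)"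
  let ?M = "\<lambda>P. lead_coeff P = 1 \<and> ?I P \<and> (\<forall>Q. ?I Q \<longrightarrow> P dvd Q)"
  obtain P where P: "P \<noteq> 0" "?I P" "\<And>Q. Q \<noteq> 0 \<Longrightarrow> ?I Q \<Longrightarrow> degree P \<le> degree Q"
    using assms ex_has_least_nat[of "\<lambda>P. P \<noteq> 0 \<and> ?I P" _ degree]
    unfolding is_recurrence_def by blast
  have dvd: "P dvd Q" if Q: "?I Q" for Q
  proof -
    have "Q mod P = Q + smult (- 1) (Q div P * P)"
      using minus_div_mult_eq_mod[of Q P] by simp
    then have "?I (Q mod P)"
      by (simp only: shift_apply_add shift_apply_smult shift_apply_mult P(2) Q shift_apply_zero_seq) simp
    moreover have "Q mod P = 0 \<or> degree (Q mod P) < degree P"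
      using P(1) by (rule degree_mod_less)
    ultimately have "Q mod P = 0" using P(3)[of "Q mod P"] by linarith
    then show ?thesis by (simp add: mod_eq_0_iff_dvd)
  qed
  define P' where "P' = smult (inverse (lead_coeff P)) P"
  have "?M P'"
    using P dvd by (auto simp: P'_def shift_apply_smult smult_dvd_iff)
  moreover have "Q = P'" if Q: "?M Q" for Q
  proof -
    obtain k where k: "Q = P' * k" using Q \<open>?M P'\<close> by (auto simp: dvd_def)
    have "lead_coeff k = 1" using Q \<open>?M P'\<close> k by (simp add: lead_coeff_mult)
    moreover have "degree Q \<le> degree P'"
      using Q \<open>?M P'\<close> by (intro dvd_imp_degree_le) auto
    then have "degree k = 0" using k Q \<open>?M P'\<close> by (subst (asm) k, subst (asm) degree_mult_eq) auto
    ultimately show ?thesis using k by (auto elim!: degree_eq_zeroE simp flip: one_pCons)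
  qed
  ultimately have "?M (min_poly_seq a)"
    unfolding min_poly_seq_def by (rule theI)
  then show "lead_coeff (min_poly_seq a) = 1" "?I (min_poly_seq a)" by auto
qed

lemma shift_apply_map_poly:
  "shift_apply (map_poly to_ac P) (\<lambda>n. to_ac (a n)) = (\<lambda>n. to_ac (shift_apply P a n))"
  by (induction P) (simp_all add: shift_apply_0 shift_apply_pCons map_poly_pCons)

text \<open>Applying \<open>[:- x, 1:]\<close> removes the root \<open>x\<close>; what remains is a
  first-order recurrence whose inhomogeneous part is an exponential sum over the other
  roots.\<close>

lemma exponential_sum_of_split_recurrence:
  fixes b :: "nat \<Rightarrow> 'b::field"
  assumes "distinct xs" "shift_apply (\<Prod>x\<leftarrow>xs. [:- x, 1:]) b = (\<lambda>_. 0)"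
  shows "\<exists>c. \<forall>n. b n = (\<Sum>x\<in>set xs. c x * x ^ n)"
  using assms
proof (induction xs arbitrary: b)
  case Nil
  then have "shift_apply (pCons 1 0) b n = 0" for n by (simp add: one_pCons)
  then show ?case by (simp add: shift_apply_pCons shift_apply_0)
next
  case (Cons x xs)
  have "(\<Prod>y\<leftarrow>x # xs. [:- y, 1:]) = (\<Prod>y\<leftarrow>xs. [:- y, 1:]) * [:- x, 1:]" by (simp only: list.map prod_list.Cons mult.commute)
  then have "shift_apply (\<Prod>y\<leftarrow>xs. [:- y, 1:]) (shift_apply [:- x, 1:] b) = (\<lambda>_. 0)"
    using Cons.prems(2) by (simp only: shift_apply_mult)
  then obtain c where c: "\<And>n. shift_apply [:- x, 1:] b n = (\<Sum>y\<in>set xs. c y * y ^ n)"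
    using Cons.IH Cons.prems(1) by force
  have step: "b (Suc n) = x * b n + (\<Sum>y\<in>set xs. c y * y ^ n)" for n
    using c[of n] by (simp add: shift_apply_pCons shift_apply_0 algebra_simps)
  \<comment> \<open>A particular solution, available because \<open>y \<noteq> x\<close>; the
    constant \<open>r\<close> then adjusts the initial value.\<close>
  define c' where "c' y = c y / (y - x)" for y
  define r where "r = b 0 - (\<Sum>y\<in>set xs. c' y)"
  have x: "x \<notin> set xs" using Cons.prems(1) by simp
  have c': "c' y * y ^ Suc n = x * (c' y * y ^ n) + c y * y ^ n" if "y \<in> set xs" for y n
  proof -
    have "c' y * (y - x) = c y" using that x by (auto simp: c'_def)
    then have "c y * y ^ n = c' y * (y - x) * y ^ n" by simp
    then show ?thesis by (simp add: algebra_simps)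
  qed
  have b: "b n = r * x ^ n + (\<Sum>y\<in>set xs. c' y * y ^ n)" for n
  proof (induction n)
    case (Suc n)
    have "(\<Sum>y\<in>set xs. c' y * y ^ Suc n) =
        x * (\<Sum>y\<in>set xs. c' y * y ^ n) + (\<Sum>y\<in>set xs. c y * y ^ n)"
      unfolding sum_distrib_left sum.distrib[symmetric] using c' by (intro sum.cong) auto
    then show ?case unfolding step Suc by (simp add: algebra_simps)
  qed (simp add: r_def)
  have "b n = (\<Sum>y\<in>set (x # xs). (c'(x := r)) y * y ^ n)" for n
  proof -
    have "(\<Sum>y\<in>set xs. (c'(x := r)) y * y ^ n) = (\<Sum>y\<in>set xs. c' y * y ^ n)"
      using x by (intro sum.cong) auto
    then show ?thesis using x b[of n] by simp
  qed
  then show ?case by blast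
qed

lemma rsquarefree_factorization:
  fixes Q :: "'b::alg_closed_field poly"
  assumes "rsquarefree Q" "lead_coeff Q = 1"
  obtains xs where "distinct xs" "length xs = degree Q" "Q = (\<Prod>x\<leftarrow>xs. [:- x, 1:])"
proof -
  have "Q \<noteq> 0" using assms by auto
  then obtain A where A: "size A = degree Q" "Q = (\<Prod>x\<in>#A. [:- x, 1:])"
    using alg_closed_imp_factorization[of Q] assms(2) by auto
  obtain xs where xs: "mset xs = A" using ex_mset by blast
  then have Q: "Q = (\<Prod>x\<leftarrow>xs. [:- x, 1:])"
    using A(2) by (metis mset_map prod_mset_prod_list)
  have "distinct xs"
  proof (rule ccontr)
    assume "\<not> distinct xs"
    then obtain us x vs ws where xs': "xs = us @ [x] @ vs @ [x] @ ws" using not_distinct_decomp by metis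
    define g where "g ys = (\<Prod>y\<leftarrow>ys. [:- y, 1:])" for ys :: "'b list"
    have "Q = g us * ([:- x, 1:] * (g vs * ([:- x, 1:] * g ws)))"
      unfolding Q xs' g_def by (simp only: map_append prod_list.append list.map prod_list.Cons
          prod_list.Nil mult_1_right)
    also have "\<dots> = [:- x, 1:] ^ 2 * (g us * g vs * g ws)"
      unfolding power2_eq_square by (simp only: mult_ac)
    finally have "[:- x, 1:] ^ 2 dvd Q" by (rule dvdI)
    then have "order x Q \<ge> 2" using order_divides \<open>Q \<noteq> 0\<close> by blast
    moreover have "order x Q \<le> 1" using assms(1) unfolding rsquarefree_def by (metis le_numeral_extra(4) zero_le)
    ultimately show False by simp
  qed
  then show ?thesis using that Q A(1) xs by (metis size_mset)
qed

theorem theorem2p7: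
  fixes a :: "nat \<Rightarrow> 'a::field"
  assumes "CHAR('a) > 0"
    and "a \<noteq> (\<lambda>_. 0)"
    and "is_recurrence a"
    and "simple_seq a"
    and "nondegenerate_seq a"
    and "seq_order a = d"
  shows "p_nested_le CHAR('a) (int d - 2) (zero_set a)"
proof -
  let ?Q = "map_poly to_ac (min_poly_seq a)" and ?b = "\<lambda>n. to_ac (a n)"
  have "lead_coeff ?Q = 1"
    using min_poly_seq_props(1)[OF assms(3)] by (simp add: degree_map_poly coeff_map_poly)
  then obtain xs where xs: "distinct xs" "length xs = degree ?Q" "?Q = (\<Prod>x\<leftarrow>xs. [:- x, 1:])"
    using rsquarefree_factorization assms(4) unfolding simple_seq_def by blast
  have d: "length xs = d"
    using xs(2) assms(6) by (simp add: seq_order_def degree_map_poly)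
  have root: "x \<in> roots_ac (min_poly_seq a)" if "x \<in> set xs" for x
  proof -
    have "poly (\<Prod>y\<leftarrow>ys. [:- y, 1:]) x = 0" if "x \<in> set ys" for ys
      using that by (induction ys) auto
    then show ?thesis using that unfolding roots_ac_def xs(3) by simp
  qed
  have "shift_apply ?Q ?b = (\<lambda>_. 0)"
    using min_poly_seq_props(2)[OF assms(3)] by (simp add: shift_apply_map_poly)
  then obtain c' where c': "\<And>n. ?b n = (\<Sum>x\<in>set xs. c' x * x ^ n)"
    using exponential_sum_of_split_recurrence[OF xs(1)] unfolding xs(3) by blast
  \<comment> \<open>The value 1 beyond \<open>d\<close> is a filler that satisfies
    \<open>\<alpha>_nonzero\<close>.\<close>
  define \<alpha> where "\<alpha> i = (if i < d then xs ! i else 1)" for i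
  define c where "c i = c' (\<alpha> i)" for i
  have b: "?b n = (\<Sum>i<d. c i * \<alpha> i ^ n)" for n
  proof -
    have "(\<Sum>x\<in>set xs. c' x * x ^ n) = (\<Sum>x\<leftarrow>xs. c' x * x ^ n)"
      using xs(1) by (simp add: sum_list_distinct_conv_sum_set)
    also have "\<dots> = (\<Sum>i<d. c' (xs ! i) * (xs ! i) ^ n)"
      by (simp add: sum_list_sum_nth d atLeast0LessThan)
    also have "\<dots> = (\<Sum>i<d. c i * \<alpha> i ^ n)"
      by (intro sum.cong) (auto simp: c_def \<alpha>_def)
    finally show ?thesis using c' by simp
  qed
  have \<alpha>_root: "\<alpha> i \<in> roots_ac (min_poly_seq a)" if "i < d" for i
    using that d by (intro root) (auto simp: \<alpha>_def)
  interpret frobenius_diagonal \<alpha> d "CHAR('a)"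
  proof
    show "\<alpha> i \<noteq> 0" for i
      using \<alpha>_root[of i] assms(5) by (cases "i < d") (auto simp: nondegenerate_seq_def \<alpha>_def)
    show "\<alpha> i ^ n \<noteq> \<alpha> j ^ n" if "i < d" "j < d" "i \<noteq> j" "n > 0" for i j n
    proof
      assume eq: "\<alpha> i ^ n = \<alpha> j ^ n"
      have "\<alpha> i \<noteq> \<alpha> j" using that xs(1) d by (simp add: \<alpha>_def nth_eq_iff_index_eq)
      moreover have "\<alpha> j \<noteq> 0"
        using \<alpha>_root[OF that(2)] assms(5) by (auto simp: nondegenerate_seq_def)
      then have "(\<alpha> i / \<alpha> j) ^ n = 1" using eq by (simp add: power_divide)
      ultimately show False
        using \<alpha>_root[OF that(1)] \<alpha>_root[OF that(2)] assms(5) that(4)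
        unfolding nondegenerate_seq_def by blast
    qed
    show "\<exists>y. y ^ CHAR('a) = x" for x :: "'a alg_closure"
      using assms(1) by (rule nth_root_exists)
  qed (use assms(1) in auto)
  have zero: "zero_set a = {n. (\<Sum>i<d. c i * \<alpha> i ^ n) = 0}"
    unfolding zero_set_def b[symmetric] by simp
  have "\<exists>i<d. c i \<noteq> 0"
  proof (rule ccontr)
    assume "\<not> (\<exists>i<d. c i \<noteq> 0)"
    then have "?b n = 0" for n unfolding b by simp
    then show False using assms(2) by auto
  qed
  then obtain i where i: "i < d" "c i \<noteq> 0" by blast
  show ?thesis
  proof (cases "d \<ge> 2")
    case True
    obtain e where "e > 0" "cov (CHAR('a) ^ e) (annihilator {c}) (zero_set a) (d - 2)"
      using cov_exponential_sum[of i c] i True unfolding zero by blast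
    moreover have "zero_set a = Z (annihilator {c})"
      by (simp add: Z_def pt_annihilator_iff zero)
    ultimately show ?thesis
      using p_nested_of_cov[of e "annihilator {c}" "d - 2"] True by (simp add: of_nat_diff)
  next
    case False
    \<comment> \<open>A single exponential term with nonzero coefficient and base never vanishes,
      which fits the negative bound \<open>d - 2 = -1\<close>.\<close>
    then have "d = 1" "i = 0" using i by auto
    then have "zero_set a = {}" using i unfolding zero by simp
    then show ?thesis
      unfolding p_nested_le_def by (intro exI[of _ "{}"]) simp
  qed
qed

end
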